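(* Let $\mathbb{K}=\bigcup_{m\ge 1}\mathbb{R}((t^{1/m}))$ and let $I\subseteq \mathbb{K}[x_1,\ldots,x_n]$ be a real radical zero-dimensional ideal such that $\mathcal{V}(I)\subseteq(\mathbb{K}^* )^n$. Then $I$ admits a real tropical basis.
   Context: $\mathbb{K}$ is the real closed field of real Puiseux series; the valuation $v(x)\in\mathbb{Q}$ of $x\in\mathbb{K}^*$ is the least exponent of $t$ occurring in $x$, and $x>0$ iff the coefficient of its least-exponent term is positive. Put $\mathbb{TR}=\{1,-1\}\times\mathbb{R}$ (with the product topology) and $trop:\mathbb{K}^*\to\mathbb{TR}$, $trop(x)=(s(x),v(x))$ with $s(x)=\pm1$ the sign of $x$; $trop$ is applied component-wise on $(\mathbb{K}^* )^n$. For $a=(\sigma,\alpha)\in\mathbb{TR}$ write $s(a)=\sigma$ and $|a|=\alpha$; for $p\in\mathbb{TR}^n$, $|p|=(|p_1|,\ldots,|p_n|)$. For an ideal $I$, $\mathcal{V}(I)$ is its set of zeros with coordinates in $\mathbb{K}$, and $trop(\mathcal{V}(I))$ denotes the closure in $\mathbb{TR}^n$ of the image under $trop$ of $\mathcal{V}(I)\cap(\mathbb{K}^* )^n$. For a polynomial $F=\sum_{\ell\in A}a_\ell x^\ell$ with support $A$ (all $a_\ell\ne0$), $\mathcal{T}_{\mathbb{R}}(F)\subseteq\mathbb{TR}^n$ is the set of points $p$ for which there are two exponents $i\neq j$ in $A$, both attaining $\min_{\ell\in A}\big(v(a_\ell)+\langle \ell,|p|\rangle\big)$, such that $s(a_i)\prod_{k=1}^n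 s(p_k)^{i_k}=1$ and $s(a_j)\prod_{k=1}^n s(p_k)^{j_k}=-1$. A real tropical basis of $I$ is a finite set $\{F_1,\ldots,F_r\}$ generating $I$ such that $trop(\mathcal{V}(I))=\bigcap_{i=1}^r\mathcal{T}_{\mathbb{R}}(F_i)$. An ideal $I$ is real radical if $I=\sqrt[\mathbb{R}]{I}$, where $\sqrt[\mathbb{R}]{I}$ is the set of $F$ for which there exist $m>0$ and polynomials $G_1,\ldots,G_r$ with $F^{2m}+\sum_{i=1}^r G_i^2\in I$. *)

theory Defs
  imports
    "HOL-Analysis.Analysis"
    "HOL-Library.Poly_Mapping"
    "HOL-Computational_Algebra.Formal_Laurent_Series"
begin

unbundle fps_syntax

section \<open>The field of real Puiseux series\<close>

text \<open>
  The Laurent series \<open>g\<close> in the variable \<open>t\<^bsup>1/m\<^esup>\<close>, given by its coefficients: the coefficient of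
  \<open>t\<^bsup>q\<^esup>\<close> is the one of index \<open>m q\<close> in \<open>g\<close> if \<open>m q\<close> is an integer, and zero otherwise.
\<close>

definition laurent_root :: "nat \<Rightarrow> real fls \<Rightarrow> rat \<Rightarrow> real" where
  "laurent_root m g = (\<lambda>q. if of_nat m * q \<in> \<int> then g $$ \<lfloor>of_nat m * q\<rfloor> else 0)"

typedef puiseux = "\<Union>m\<in>{1..}. range (laurent_root m)"
  morphisms puiseux_nth Abs_puiseux
  by auto

setup_lifting type_definition_puiseux

lemma puiseux_eqI: "(\<And>q. puiseux_nth x q = puiseux_nth y q) \<Longrightarrow> x = y"
  by (metis puiseux_nth_inject ext)

lemma laurent_root_in: "m > 0 \<Longrightarrow> laurent_root m g \<in> (\<Union>m\<in>{1..}. range (laurent_root m))"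
  by force

lemma laurent_root_rescale:
  assumes "m > 0" "k > 0"
  shows "laurent_root m g = laurent_root (m * k) (fls_compose_power g k)"
proof
  fix q :: rat
  show "laurent_root m g q = laurent_root (m * k) (fls_compose_power g k) q"
  proof (cases "of_nat (m * k) * q \<in> \<int>")
    case True
    then obtain z where z: "of_nat (m * k) * q = of_int z"
      by (auto elim: Ints_cases)
    show ?thesis
    proof (cases "int k dvd z")
      case True
      then obtain w where w: "z = int k * w" by auto
      have "of_nat m * q = of_int w"
        using z assms by (simp add: w)
      then show ?thesis unfolding laurent_root_def z w using assms
        by (simp add: fls_nth_compose_power del: of_int_mult)
    next
      case False
      have "of_nat m * q \<notin> \<int>"
      proof
        assume "of_nat m * q \<in> \<int>"
        then obtain w where w: "of_nat m * q = of_int w" by (auto elim: Ints_cases)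
        have "(of_int z :: rat) = of_nat k * (of_nat m * q)" by (simp flip: z)
        then have "(of_int z :: rat) = of_int (int k * w)" by (simp add: w)
        then have "z = int k * w" using of_int_eq_iff by blast
        with False show False by simp
      qed
      then show ?thesis using z False assms by (simp add: laurent_root_def fls_nth_compose_power)
    qed
  next
    case False
    have "of_nat m * q \<notin> \<int>"
    proof
      assume "of_nat m * q \<in> \<int>"
      then have "of_nat k * (of_nat m * q) \<in> \<int>" by (rule Ints_mult[OF Ints_of_nat])
      also have "of_nat k * (of_nat m * q) = of_nat (m * k) * q" by simp
      finally show False using False by blast
    qed
    then show ?thesis using False by (simp add: laurent_root_def)
  qed
qed

lemma puiseux_common1:
  obtains m f where "m > 0" "puiseux_nth x = laurent_root m f"
  using puiseux_nth[of x] by (auto simp: Suc_le_eq)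

lemma puiseux_common2:
  obtains m f g where "m > 0" "puiseux_nth x = laurent_root m f" "puiseux_nth y = laurent_root m g"
proof -
  obtain a f where a: "a > 0" "puiseux_nth x = laurent_root a f" by (rule puiseux_common1)
  obtain b g where b: "b > 0" "puiseux_nth y = laurent_root b g" by (rule puiseux_common1)
  show thesis
    by (rule that[of "a * b"])
       (use a b laurent_root_rescale[of a b f] laurent_root_rescale[of b a g] in \<open>simp_all add: mult.commute\<close>)
qed

lemma puiseux_common3:
  obtains m f g h where "m > 0" "puiseux_nth x = laurent_root m f"
    "puiseux_nth y = laurent_root m g" "puiseux_nth z = laurent_root m h"
proof -
  obtain a f g where a: "a > 0" "puiseux_nth x = laurent_root a f" "puiseux_nth y = laurent_root a g"
    by (rule puiseux_common2)
  obtain b h where b: "b > 0" "puiseux_nth z = laurent_root b h" by (rule puiseux_common1)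
  show thesis
    by (rule that[of "a * b"])
       (use a b laurent_root_rescale[of a b f] laurent_root_rescale[of a b g]
          laurent_root_rescale[of b a h] in \<open>simp_all add: mult.commute\<close>)
qed

lemma laurent_root_zero: "(\<lambda>q. 0) = laurent_root m 0"
  by (simp add: laurent_root_def fun_eq_iff)

lemma laurent_root_one: "m > 0 \<Longrightarrow> (\<lambda>q. if q = 0 then 1 else 0) = laurent_root m 1"
proof (rule ext)
  fix q :: rat
  assume "m > 0"
  then show "(if q = 0 then 1 else 0) = laurent_root m 1 q"
    by (cases "of_nat m * q \<in> \<int>") (auto simp: laurent_root_def elim!: Ints_cases)
qed

lemma laurent_root_add: "(\<lambda>q. laurent_root m f q + laurent_root m g q) = laurent_root m (f + g)"
  by (auto simp: laurent_root_def fun_eq_iff)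

lemma laurent_root_uminus: "(\<lambda>q. - laurent_root m f q) = laurent_root m (- f)"
  by (auto simp: laurent_root_def fun_eq_iff)

lemma laurent_root_diff: "(\<lambda>q. laurent_root m f q - laurent_root m g q) = laurent_root m (f - g)"
  by (auto simp: laurent_root_def fun_eq_iff)

text \<open>For Puiseux series the index set of the following sum is finite.\<close>

definition series_mult :: "(rat \<Rightarrow> real) \<Rightarrow> (rat \<Rightarrow> real) \<Rightarrow> rat \<Rightarrow> real" where
  "series_mult f g = (\<lambda>q. \<Sum>a | f a \<noteq> 0 \<and> g (q - a) \<noteq> 0. f a * g (q - a))"

lemma laurent_root_mult:
  assumes m: "m > 0"
  shows "series_mult (laurent_root m f) (laurent_root m g) = laurent_root m (f * g)"
proof
  fix q :: rat
  let ?M = "of_nat m :: rat"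
  let ?S = "{a. laurent_root m f a \<noteq> 0 \<and> laurent_root m g (q - a) \<noteq> 0}"
  show "series_mult (laurent_root m f) (laurent_root m g) q = laurent_root m (f * g) q"
  proof (cases "?M * q \<in> \<int>")
    case True
    then obtain n where n: "?M * q = of_int n" by (auto elim: Ints_cases)
    let ?T = "{i. f $$ i \<noteq> 0 \<and> g $$ (n - i) \<noteq> 0}"
    have nth: "laurent_root m f (of_int i / ?M) = f $$ i" for i f
      using m by (simp add: laurent_root_def)
    have diff: "q - of_int i / ?M = of_int (n - i) / ?M" for i
      using n m by (simp add: field_simps)
    have S: "?S = (\<lambda>i. of_int i / ?M) ` ?T"
    proof (intro equalityI subsetI)
      fix a assume a: "a \<in> ?S"
      then have "?M * a \<in> \<int>" by (auto simp: laurent_root_def split: if_splits)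
      then obtain i where "?M * a = of_int i" by (auto elim: Ints_cases)
      then have ai: "a = of_int i / ?M" using m by (simp add: field_simps)
      show "a \<in> (\<lambda>i. of_int i / ?M) ` ?T"
        using a unfolding ai mem_Collect_eq diff nth by blast
    qed (auto simp only: diff nth mem_Collect_eq)
    have inj: "inj_on (\<lambda>i. of_int i / ?M) ?T" using m by (auto simp: inj_on_def)
    have "series_mult (laurent_root m f) (laurent_root m g) q = (\<Sum>i\<in>?T. f $$ i * g $$ (n - i))"
      unfolding series_mult_def S sum.reindex[OF inj] o_def diff nth ..
    also have "\<dots> = (\<Sum>i=fls_subdegree f..n - fls_subdegree g. f $$ i * g $$ (n - i))"
    proof (rule sum.mono_neutral_left)
      show "?T \<subseteq> {fls_subdegree f..n - fls_subdegree g}"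
        using fls_subdegree_leI[of f] fls_subdegree_leI[of g] by force
    qed auto
    also have "\<dots> = (f * g) $$ n" by (simp add: fls_times_nth(2))
    finally show ?thesis using n by (simp add: laurent_root_def)
  next
    case False
    have "?S = {}"
    proof (rule ccontr)
      assume "?S \<noteq> {}"
      then obtain a where "?M * a \<in> \<int>" "?M * (q - a) \<in> \<int>"
        by (auto simp: laurent_root_def split: if_splits)
      then have "?M * a + ?M * (q - a) \<in> \<int>" by (rule Ints_add)
      with False show False by (simp add: algebra_simps)
    qed
    then show ?thesis unfolding series_mult_def using False
      by (simp only: sum.empty) (simp add: laurent_root_def)
  qed
qed

lemma laurent_root_inject: "m > 0 \<Longrightarrow> laurent_root m f = laurent_root m g \<longleftrightarrow> f = g"
proof
  assume m: "m > 0" and eq: "laurent_root m f = laurent_root m g"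
  show "f = g"
  proof (rule fls_eqI)
    fix n
    from eq have "laurent_root m f (of_int n / of_nat m) = laurent_root m g (of_int n / of_nat m)"
      by simp
    then show "f $$ n = g $$ n" using m by (simp add: laurent_root_def)
  qed
qed simp

instantiation puiseux :: comm_ring_1
begin

lift_definition zero_puiseux :: puiseux is "\<lambda>q. 0"
  using laurent_root_in[of 1 0] laurent_root_zero[of 1] by simp

lift_definition one_puiseux :: puiseux is "\<lambda>q. if q = 0 then 1 else 0"
  using laurent_root_in[of 1 1] laurent_root_one[of 1] by simp

lift_definition plus_puiseux :: "puiseux \<Rightarrow> puiseux \<Rightarrow> puiseux" is "\<lambda>f g q. f q + g q"
proof -
  fix f g assume "f \<in> (\<Union>m\<in>{1..}. range (laurent_root m))" "g \<in> (\<Union>m\<in>{1..}. range (laurent_root m))"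
  then obtain x y where "f = puiseux_nth x" "g = puiseux_nth y" by (metis puiseux_nth_cases)
  moreover obtain m f' g' where "m > 0" "puiseux_nth x = laurent_root m f'" "puiseux_nth y = laurent_root m g'"
    by (rule puiseux_common2)
  ultimately show "(\<lambda>q. f q + g q) \<in> (\<Union>m\<in>{1..}. range (laurent_root m))"
    by (simp only: laurent_root_add laurent_root_in)
qed

lift_definition uminus_puiseux :: "puiseux \<Rightarrow> puiseux" is "\<lambda>f q. - f q"
proof -
  fix f assume "f \<in> (\<Union>m\<in>{1..}. range (laurent_root m))"
  then obtain x where "f = puiseux_nth x" by (metis puiseux_nth_cases)
  moreover obtain m f' where "m > 0" "puiseux_nth x = laurent_root m f'"
    by (rule puiseux_common1)
  ultimately show "(\<lambda>q. - f q) \<in> (\<Union>m\<in>{1..}. range (laurent_root m))"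
    by (simp only: laurent_root_uminus laurent_root_in)
qed

lift_definition minus_puiseux :: "puiseux \<Rightarrow> puiseux \<Rightarrow> puiseux" is "\<lambda>f g q. f q - g q"
proof -
  fix f g assume "f \<in> (\<Union>m\<in>{1..}. range (laurent_root m))" "g \<in> (\<Union>m\<in>{1..}. range (laurent_root m))"
  then obtain x y where "f = puiseux_nth x" "g = puiseux_nth y" by (metis puiseux_nth_cases)
  moreover obtain m f' g' where "m > 0" "puiseux_nth x = laurent_root m f'" "puiseux_nth y = laurent_root m g'"
    by (rule puiseux_common2)
  ultimately show "(\<lambda>q. f q - g q) \<in> (\<Union>m\<in>{1..}. range (laurent_root m))"
    by (simp only: laurent_root_diff laurent_root_in)
qed

lift_definition times_puiseux :: "puiseux \<Rightarrow> puiseux \<Rightarrow> puiseux" is series_mult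
proof -
  fix f g assume "f \<in> (\<Union>m\<in>{1..}. range (laurent_root m))" "g \<in> (\<Union>m\<in>{1..}. range (laurent_root m))"
  then obtain x y where "f = puiseux_nth x" "g = puiseux_nth y" by (metis puiseux_nth_cases)
  moreover obtain m f' g' where "m > 0" "puiseux_nth x = laurent_root m f'" "puiseux_nth y = laurent_root m g'"
    by (rule puiseux_common2)
  ultimately show "series_mult f g \<in> (\<Union>m\<in>{1..}. range (laurent_root m))"
    by (simp only: laurent_root_mult laurent_root_in)
qed

instance
proof
  fix a b c :: puiseux
  show "a + b + c = a + (b + c)" by transfer (simp add: add.assoc)
  show "a + b = b + a" by transfer (simp add: add.commute)
  show "0 + a = a" by transfer simp
  show "- a + a = 0" by transfer simp
  show "a - b = a + - b" by transfer simp
  show "(0::puiseux) \<noteq> 1" by transfer (auto simp: fun_eq_iff)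
  obtain m f g h where m: "m > 0" and abc: "puiseux_nth a = laurent_root m f"
    "puiseux_nth b = laurent_root m g" "puiseux_nth c = laurent_root m h"
    by (rule puiseux_common3)
  note simps = puiseux_nth_inject[symmetric] times_puiseux.rep_eq plus_puiseux.rep_eq
    one_puiseux.rep_eq abc laurent_root_mult[OF m] laurent_root_add laurent_root_one[OF m]
    laurent_root_inject[OF m]
  show "a * b * c = a * (b * c)" unfolding simps by (rule mult.assoc)
  show "a * b = b * a" unfolding simps by (rule mult.commute)
  show "1 * a = a" unfolding simps by simp
  show "(a + b) * c = a * c + b * c" unfolding simps by (rule distrib_right)
qed

end

lemma puiseux_inverse_ex1:
  assumes "x \<noteq> (0 :: puiseux)"
  shows "\<exists>!y. x * y = 1"
proof -
  obtain m f where m: "m > 0" and x: "puiseux_nth x = laurent_root m f" by (rule puiseux_common1)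
  have "f \<noteq> 0"
    using assms m by (auto simp: puiseux_nth_inject[symmetric] x zero_puiseux.rep_eq
      laurent_root_zero[of m])
  define y where "y = Abs_puiseux (laurent_root m (inverse f))"
  have y: "puiseux_nth y = laurent_root m (inverse f)"
    unfolding y_def using laurent_root_in[OF m] by (rule Abs_puiseux_inverse)
  have "x * y = 1"
    using \<open>f \<noteq> 0\<close> by (simp add: puiseux_nth_inject[symmetric] times_puiseux.rep_eq x y
      laurent_root_mult[OF m] one_puiseux.rep_eq laurent_root_one[OF m])
  then show ?thesis
    by (metis mult.assoc mult.commute mult_1)
qed

instantiation puiseux :: field
begin

definition inverse_puiseux :: "puiseux \<Rightarrow> puiseux" where
  "inverse_puiseux x = (if x = 0 then 0 else (THE y. x * y = 1))"

definition divide_puiseux :: "puiseux \<Rightarrow> puiseux \<Rightarrow> puiseux" where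
  "divide_puiseux x y = x * inverse y"

instance
proof
  fix a b :: puiseux
  show "inverse a * a = 1" if "a \<noteq> 0"
    using theI'[OF puiseux_inverse_ex1[OF that]] that
    by (simp add: inverse_puiseux_def mult.commute)
qed (simp_all add: divide_puiseux_def inverse_puiseux_def)

end

text \<open>Only meaningful for nonzero arguments.\<close>

definition puiseux_val :: "puiseux \<Rightarrow> rat" where
  "puiseux_val x = (LEAST q. puiseux_nth x q \<noteq> 0)"

definition puiseux_lead :: "puiseux \<Rightarrow> real" where
  "puiseux_lead x = puiseux_nth x (puiseux_val x)"

lemma puiseux_nth_support:
  assumes m: "m > 0" and x: "puiseux_nth x = laurent_root m f" and q: "puiseux_nth x q \<noteq> 0"
  shows "of_int (fls_subdegree f) / of_nat m \<le> q"
proof -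
  from q have "of_nat m * q \<in> \<int>" by (auto simp: x laurent_root_def split: if_splits)
  then obtain z where z: "of_nat m * q = of_int z" by (auto elim: Ints_cases)
  with q have "f $$ z \<noteq> 0" by (simp add: x laurent_root_def)
  then have "(of_int (fls_subdegree f) :: rat) \<le> of_nat m * q"
    unfolding z of_int_le_iff by (rule fls_subdegree_leI)
  then show ?thesis using m by (simp add: field_simps)
qed

lemma puiseux_val_laurent_root:
  assumes m: "m > 0" and x: "puiseux_nth x = laurent_root m f" and f: "f \<noteq> 0"
  shows "puiseux_val x = of_int (fls_subdegree f) / of_nat m"
  unfolding puiseux_val_def
proof (rule Least_equality)
  show "puiseux_nth x (of_int (fls_subdegree f) / of_nat m) \<noteq> 0"
    using m f by (simp add: x laurent_root_def)
qed (rule puiseux_nth_support[OF m x])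

lemma puiseux_lead_laurent_root:
  assumes m: "m > 0" and x: "puiseux_nth x = laurent_root m f"
  shows "puiseux_lead x = f $$ fls_subdegree f"
proof (cases "f = 0")
  case True
  then show ?thesis by (simp add: puiseux_lead_def x laurent_root_def)
next
  case False
  show ?thesis
    unfolding puiseux_lead_def puiseux_val_laurent_root[OF assms False] x
    using m by (simp add: laurent_root_def)
qed

lemma puiseux_lead_0 [simp]: "puiseux_lead 0 = 0"
  by (simp add: puiseux_lead_def zero_puiseux.rep_eq)

lemma puiseux_lead_eq_0_iff [simp]: "puiseux_lead x = 0 \<longleftrightarrow> x = 0"
proof
  assume *: "puiseux_lead x = 0"
  obtain m f where m: "m > 0" and x: "puiseux_nth x = laurent_root m f" by (rule puiseux_common1)
  have "f = 0" using * nth_fls_subdegree_nonzero[of f] by (auto simp: puiseux_lead_laurent_root[OF m x])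
  then show "x = 0"
    by (simp add: puiseux_nth_inject[symmetric] x zero_puiseux.rep_eq laurent_root_zero[of m])
qed simp

lemma puiseux_nth_eq_0:
  assumes "q < puiseux_val x"
  shows "puiseux_nth x q = 0"
proof (rule ccontr)
  assume nz: "puiseux_nth x q \<noteq> 0"
  obtain m f where m: "m > 0" and x: "puiseux_nth x = laurent_root m f" by (rule puiseux_common1)
  from nz have f: "f \<noteq> 0" by (auto simp: x laurent_root_def split: if_splits)
  show False
    using puiseux_nth_support[OF m x nz] puiseux_val_laurent_root[OF m x f] assms by simp
qed

lemma puiseux_lead_uminus: "puiseux_lead (- x) = - puiseux_lead x"
  by (simp add: puiseux_lead_def puiseux_val_def uminus_puiseux.rep_eq)

lemma puiseux_lead_mult: "puiseux_lead (x * y) = puiseux_lead x * puiseux_lead y"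
proof -
  obtain m f g where m: "m > 0" and x: "puiseux_nth x = laurent_root m f"
    and y: "puiseux_nth y = laurent_root m g"
    by (rule puiseux_common2)
  have xy: "puiseux_nth (x * y) = laurent_root m (f * g)"
    by (simp add: times_puiseux.rep_eq x y laurent_root_mult[OF m])
  show ?thesis
    unfolding puiseux_lead_laurent_root[OF m x] puiseux_lead_laurent_root[OF m y]
      puiseux_lead_laurent_root[OF m xy]
    by (cases "f = 0 \<or> g = 0") (auto simp: fls_times_base)
qed

lemma puiseux_lead_eqI:
  assumes "puiseux_nth x q \<noteq> 0" "\<And>r. r < q \<Longrightarrow> puiseux_nth x r = 0"
  shows "puiseux_lead x = puiseux_nth x q"
proof -
  have "puiseux_val x = q"
    unfolding puiseux_val_def using assms by (intro Least_equality) (auto simp: not_less[symmetric])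
  then show ?thesis by (simp add: puiseux_lead_def)
qed

lemma puiseux_lead_add_pos:
  assumes "puiseux_lead x > 0" "puiseux_lead y > 0"
  shows "puiseux_lead (x + y) > 0"
proof -
  let ?q = "min (puiseux_val x) (puiseux_val y)"
  have "puiseux_nth (x + y) ?q > 0"
    using assms puiseux_nth_eq_0[of "puiseux_val x" y] puiseux_nth_eq_0[of "puiseux_val y" x]
    by (cases "puiseux_val x" "puiseux_val y" rule: linorder_cases)
       (auto simp: plus_puiseux.rep_eq puiseux_lead_def)
  moreover have "puiseux_nth (x + y) r = 0" if "r < ?q" for r
    using that by (simp add: plus_puiseux.rep_eq puiseux_nth_eq_0)
  ultimately show ?thesis using puiseux_lead_eqI[of "x + y" ?q] by simp
qed

instantiation puiseux :: linordered_field
begin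

definition less_puiseux :: "puiseux \<Rightarrow> puiseux \<Rightarrow> bool" where
  "x < y \<longleftrightarrow> puiseux_lead (y - x) > 0"

definition less_eq_puiseux :: "puiseux \<Rightarrow> puiseux \<Rightarrow> bool" where
  "x \<le> y \<longleftrightarrow> x = y \<or> x < y" for x y :: puiseux

definition abs_puiseux :: "puiseux \<Rightarrow> puiseux" where
  "\<bar>x\<bar> = (if x < 0 then - x else x)" for x :: puiseux

definition sgn_puiseux :: "puiseux \<Rightarrow> puiseux" where
  "sgn x = (if x = 0 then 0 else if 0 < x then 1 else - 1)" for x :: puiseux

instance
proof
  fix x y z :: puiseux
  have neg: "puiseux_lead (y - x) = - puiseux_lead (x - y)" for x y
    using puiseux_lead_uminus[of "x - y"] by simp
  have trans: "x < z" if "x < y" "y < z" for x y z :: puiseux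
    using puiseux_lead_add_pos[of "y - x" "z - y"] that by (simp add: less_puiseux_def)
  show "x < y \<longleftrightarrow> x \<le> y \<and> \<not> y \<le> x"
    using neg[of y x] by (auto simp: less_eq_puiseux_def less_puiseux_def)
  show "x \<le> x" by (simp add: less_eq_puiseux_def)
  show "x \<le> z" if "x \<le> y" "y \<le> z" using that trans by (auto simp: less_eq_puiseux_def)
  show "x = y" if "x \<le> y" "y \<le> x"
    using that neg[of y x] by (auto simp: less_eq_puiseux_def less_puiseux_def)
  show "x \<le> y \<or> y \<le> x"
  proof (cases "x = y")
    case False
    then have "puiseux_lead (y - x) \<noteq> 0" by simp
    then show ?thesis using neg[of y x]
      by (auto simp: less_eq_puiseux_def less_puiseux_def not_less order.order_iff_strict)
  qed (simp add: less_eq_puiseux_def)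
  show "z + x \<le> z + y" if "x \<le> y"
    using that by (auto simp: less_eq_puiseux_def less_puiseux_def)
  show "z * x < z * y" if "x < y" "0 < z"
    using that puiseux_lead_mult[of z "y - x"] by (simp add: less_puiseux_def right_diff_distrib)
qed (auto simp: abs_puiseux_def sgn_puiseux_def)

end

lemma puiseux_pos_iff: "0 < x \<longleftrightarrow> puiseux_nth x (puiseux_val x) > 0"
  by (simp add: less_puiseux_def puiseux_lead_def)

unbundle no fps_syntax

section \<open>Polynomials, ideals and varieties\<close>

text \<open>
  The polynomial ring in finitely many variables, indexed by the finite type \<open>'n\<close>; exponent vectors
  have type \<open>'n \<Rightarrow>\<^sub>0 nat\<close>, and multiplication on the outer \<open>\<Rightarrow>\<^sub>0\<close> is convolution.
\<close>

type_synonym 'n kpoly = "('n \<Rightarrow>\<^sub>0 nat) \<Rightarrow>\<^sub>0 puiseux"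

definition poly_eval :: "'n::finite kpoly \<Rightarrow> puiseux ^ 'n \<Rightarrow> puiseux" where
  "poly_eval F x =
     (\<Sum>l\<in>Poly_Mapping.keys F. Poly_Mapping.lookup F l * (\<Prod>k\<in>UNIV. (x $ k) ^ Poly_Mapping.lookup l k))"

text \<open>Ideals of a commutative ring are its submodules, viewed as a module over itself.\<close>

lemma module_times: "module ((*) :: 'a::comm_ring_1 \<Rightarrow> 'a \<Rightarrow> 'a)"
  by standard (simp_all add: algebra_simps)

definition is_ideal :: "'a::comm_ring_1 set \<Rightarrow> bool" where
  "is_ideal I \<longleftrightarrow> module.subspace (*) I"

lemma is_ideal_iff:
  "is_ideal I \<longleftrightarrow> 0 \<in> I \<and> (\<forall>x\<in>I. \<forall>y\<in>I. x + y \<in> I) \<and> (\<forall>c. \<forall>x\<in>I. c * x \<in> I)"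
  unfolding is_ideal_def module.subspace_def[OF module_times] ..

definition ideal_gen :: "'a::comm_ring_1 set \<Rightarrow> 'a set" where
  "ideal_gen B = module.span (*) B"

definition is_prime_ideal :: "'a::comm_ring_1 set \<Rightarrow> bool" where
  "is_prime_ideal P \<longleftrightarrow> is_ideal P \<and> P \<noteq> UNIV \<and> (\<forall>a b. a * b \<in> P \<longrightarrow> a \<in> P \<or> b \<in> P)"

text \<open>
  The Krull dimension of the quotient ring by \<open>I\<close>: primes of the quotient are the primes
  containing \<open>I\<close>. The unit ideal gets \<open>Sup {} = -\<infinity>\<close>.
\<close>

definition ideal_dim :: "'a::comm_ring_1 set \<Rightarrow> ereal" where
  "ideal_dim I = Sup {ereal (real d) | d. \<exists>P :: nat \<Rightarrow> 'a set.
     (\<forall>i\<le>d. is_prime_ideal (P i) \<and> I \<subseteq> P i) \<and> (\<forall>i<d. P i \<subset> P (Suc i))}"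

definition zero_dimensional :: "'a::comm_ring_1 set \<Rightarrow> bool" where
  "zero_dimensional I \<longleftrightarrow> ideal_dim I = 0"

definition real_radical_of :: "'a::comm_ring_1 set \<Rightarrow> 'a set" where
  "real_radical_of I = {F. \<exists>m>0. \<exists>r. \<exists>G :: nat \<Rightarrow> 'a. F ^ (2 * m) + (\<Sum>i<r. (G i)\<^sup>2) \<in> I}"

definition real_radical :: "'a::comm_ring_1 set \<Rightarrow> bool" where
  "real_radical I \<longleftrightarrow> real_radical_of I = I"

definition variety :: "'n::finite kpoly set \<Rightarrow> (puiseux ^ 'n) set" where
  "variety I = {x. \<forall>F\<in>I. poly_eval F x = 0}"

definition torus :: "(puiseux ^ 'n::finite) set" where
  "torus = {x. \<forall>k. x $ k \<noteq> 0}"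

section \<open>Real tropical geometry\<close>

text \<open>
  A signed tropical number is a pair of a sign, \<open>1\<close> or \<open>-1\<close>, and a real modulus.
\<close>

definition TR :: "(real \<times> real) set" where
  "TR = {1, - 1} \<times> UNIV"

definition TRn :: "((real \<times> real) ^ 'n::finite) set" where
  "TRn = {p. \<forall>k. p $ k \<in> TR}"

text \<open>As for the valuation, the value at zero is irrelevant.\<close>

definition puiseux_sign :: "puiseux \<Rightarrow> real" where
  "puiseux_sign x = (if x > 0 then 1 else - 1)"

definition trop :: "puiseux \<Rightarrow> real \<times> real" where
  "trop x = (puiseux_sign x, real_of_rat (puiseux_val x))"

definition trop_vec :: "puiseux ^ 'n::finite \<Rightarrow> (real \<times> real) ^ 'n" where
  "trop_vec x = (\<chi> k. trop (x $ k))"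

definition trop_variety :: "'n::finite kpoly set \<Rightarrow> ((real \<times> real) ^ 'n) set" where
  "trop_variety I = top_of_set TRn closure_of (trop_vec ` (variety I \<inter> torus))"

definition trop_weight :: "'n::finite kpoly \<Rightarrow> (real \<times> real) ^ 'n \<Rightarrow> ('n \<Rightarrow>\<^sub>0 nat) \<Rightarrow> real" where
  "trop_weight F p l = real_of_rat (puiseux_val (Poly_Mapping.lookup F l))
     + (\<Sum>k\<in>UNIV. real (Poly_Mapping.lookup l k) * snd (p $ k))"

definition trop_sign :: "'n::finite kpoly \<Rightarrow> (real \<times> real) ^ 'n \<Rightarrow> ('n \<Rightarrow>\<^sub>0 nat) \<Rightarrow> real" where
  "trop_sign F p l = puiseux_sign (Poly_Mapping.lookup F l)
     * (\<Prod>k\<in>UNIV. fst (p $ k) ^ Poly_Mapping.lookup l k)"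

definition trop_hypersurface :: "'n::finite kpoly \<Rightarrow> ((real \<times> real) ^ 'n) set" where
  "trop_hypersurface F = {p \<in> TRn.
     \<exists>i\<in>Poly_Mapping.keys F. \<exists>j\<in>Poly_Mapping.keys F. i \<noteq> j
       \<and> (\<forall>l\<in>Poly_Mapping.keys F. trop_weight F p i \<le> trop_weight F p l)
       \<and> (\<forall>l\<in>Poly_Mapping.keys F. trop_weight F p j \<le> trop_weight F p l)
       \<and> trop_sign F p i = 1 \<and> trop_sign F p j = - 1}"

text \<open>The empty intersection is \<open>TRn\<close>.\<close>

definition real_tropical_basis :: "'n::finite kpoly set \<Rightarrow> 'n kpoly set \<Rightarrow> bool" where
  "real_tropical_basis B I \<longleftrightarrow> finite B \<and> ideal_gen B = I
     \<and> trop_variety I = TRn \<inter> (\<Inter>F\<in>B. trop_hypersurface F)"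

end

theory Submission
  imports Defs "HOL-Computational_Algebra.Fundamental_Theorem_Algebra"
begin

text \<open>
  A zero-dimensional ideal contains a nonzero polynomial in each single variable. Over the Puiseux
  series, a nonlinear irreducible polynomial in one variable is, up to a factor, a nonzero square
  plus a sum of squares, so in a real radical ideal such factors and multiplicities can be
  cancelled. Hence the ideal contains a product of distinct linear factors in each variable, and by
  Lagrange interpolation on the resulting grid it is the ideal of the finite set \<open>V\<close> of its zeros
  and is finitely generated.

  Call a polynomial pure at \<open>p\<close> if all terms of minimal weight at \<open>p\<close> have the same sign; this is
  preserved by products. If \<open>p\<close> is not the tropicalization of a point of \<open>V\<close>, choose for each
  \<open>x \<in> V\<close> a coordinate \<open>\<phi> x\<close> in which \<open>p\<close> and \<open>x\<close> differ tropically. The product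
  over \<open>x \<in> V\<close> of the linear polynomials in the variable \<open>\<phi> x\<close> vanishing at \<open>x\<close> is pure at \<open>p\<close>
  and vanishes on \<open>V\<close>. There are finitely many functions \<open>\<phi>\<close>, so adding all these products to the
  generators gives a real tropical basis.
\<close>

section \<open>Arithmetic of Puiseux series\<close>

unbundle fps_syntax and no vec_syntax

text \<open>Cancelling a factor \<open>g\<close> needs more than nonnegativity: if a multiple of
  \<open>g\<close> is \<open>u^2 + s\<close> with \<open>u \<noteq> 0\<close> and \<open>s\<close> a
  sum of squares, then \<open>h * g\<close> in the ideal gives \<open>(u * h)^2 + h^2 * s\<close> in
  it, hence \<open>h\<close>. The nonzero \<open>u\<close> comes from a real polynomial without real
  roots, to which the coefficients of a normalized \<open>g\<close> are infinitely close. So the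
  real polynomial is bounded below by a positive multiple of all even powers, a margin that absorbs
  infinitesimal errors. A finite basis has to exclude infinitely many points \<open>p\<close>. This
  works because the excluding polynomial depends on \<open>p\<close> only through the chosen
  coordinates. Its factors are linear with two terms, since points of the variety have nonzero
  coordinates, and for two terms purity is plain. Conversely, if \<open>F\<close> is pure at the
  tropicalization of \<open>x\<close>, then the terms of least valuation in \<open>F(x)\<close> have
  one sign and cannot cancel, so \<open>F(x) \<noteq> 0\<close>. Hence the nonzero members of the
  ideal have real tropical hypersurfaces through every tropicalized zero. As the variety is finite,
  taking the closure adds no points.\<close>

definition tpow :: "rat \<Rightarrow> puiseux" where
  "tpow q = Abs_puiseux (\<lambda>r. if r = q then 1 else 0)"

lemma puiseux_nth_tpow: "puiseux_nth (tpow q) = (\<lambda>r. if r = q then 1 else 0)"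
proof -
  obtain a b where q: "quotient_of q = (a, b)" by (cases "quotient_of q")
  then have b: "b > 0" and qab: "q = of_int a / of_int b"
    by (auto simp: quotient_of_denom_pos quotient_of_div)
  have "(\<lambda>r. if r = q then 1 else 0) = laurent_root (nat b) (fls_X_intpow a)"
  proof
    fix r :: rat
    show "(if r = q then 1 else 0) = laurent_root (nat b) (fls_X_intpow a) r"
    proof (cases "of_nat (nat b) * r \<in> \<int>")
      case True
      then obtain n where n: "of_int b * r = of_int n" using b by (auto elim: Ints_cases)
      then have "r = q \<longleftrightarrow> n = a" using b by (auto simp: qab field_simps)
      then show ?thesis using True n b by (auto simp: laurent_root_def)
    next
      case False
      then show ?thesis using b by (auto simp: laurent_root_def qab)
    qed
  qed
  then show ?thesis unfolding tpow_def using b Abs_puiseux_inverse[OF laurent_root_in[of "nat b" "fls_X_intpow a"]] by simp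
qed

lemma puiseux_nth_tpow_mult: "puiseux_nth (tpow q * x) r = puiseux_nth x (r - q)"
proof -
  have "{a. (if a = q then 1 else 0) \<noteq> (0::real) \<and> puiseux_nth x (r - a) \<noteq> 0}
      = (if puiseux_nth x (r - q) = 0 then {} else {q})" by auto
  then show ?thesis by (simp add: times_puiseux.rep_eq series_mult_def puiseux_nth_tpow)
qed

lemma tpow_add: "tpow (q + r) = tpow q * tpow r"
  by (rule puiseux_eqI) (auto simp: puiseux_nth_tpow_mult puiseux_nth_tpow)

lemma tpow_0 [simp]: "tpow 0 = 1"
  by (rule puiseux_eqI) (auto simp: puiseux_nth_tpow one_puiseux.rep_eq)

lemma tpow_nz [simp]: "tpow q \<noteq> 0"
  using tpow_add[of q "- q"] by auto

lemma tpow_power: "tpow q ^ n = tpow (of_nat n * q)"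
  by (induction n) (simp_all add: tpow_add algebra_simps)

text \<open>The embedding of real power series that sends the variable to \<open>t^(1/m)\<close>. It
  makes square roots and Cauchy products of power series available for Puiseux series of nonnegative
  valuation.\<close>

definition of_fps :: "nat \<Rightarrow> real fps \<Rightarrow> puiseux" where
  "of_fps m f = Abs_puiseux (laurent_root m (fps_to_fls f))"

context
  fixes m :: nat
  assumes m: "m > 0"
begin

lemma puiseux_nth_of_fps: "puiseux_nth (of_fps m f) = laurent_root m (fps_to_fls f)"
  unfolding of_fps_def by (rule Abs_puiseux_inverse[OF laurent_root_in[OF m]])

lemma of_fps_0 [simp]: "of_fps m 0 = 0"
  by (rule puiseux_eqI) (simp add: puiseux_nth_of_fps zero_puiseux.rep_eq laurent_root_def)

lemma of_fps_1 [simp]: "of_fps m 1 = 1"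
  by (simp add: puiseux_nth_inject[symmetric] puiseux_nth_of_fps one_puiseux.rep_eq laurent_root_one[OF m])

lemma of_fps_add: "of_fps m (f + g) = of_fps m f + of_fps m g"
  by (simp add: puiseux_nth_inject[symmetric] puiseux_nth_of_fps plus_puiseux.rep_eq laurent_root_add)

lemma of_fps_mult: "of_fps m (f * g) = of_fps m f * of_fps m g"
  by (simp add: puiseux_nth_inject[symmetric] puiseux_nth_of_fps times_puiseux.rep_eq
      laurent_root_mult[OF m] fls_times_fps_to_fls)

lemma of_fps_sum: "of_fps m (\<Sum>x\<in>A. f x) = (\<Sum>x\<in>A. of_fps m (f x))"
  by (induction A rule: infinite_finite_induct) (simp_all add: of_fps_add)

lemma puiseux_nth_of_fps_nonpos: "r \<le> 0 \<Longrightarrow> puiseux_nth (of_fps m f) r = (if r = 0 then f $ 0 else 0)"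
proof -
  assume r: "r \<le> 0"
  have "(of_nat m * r < 0) = (r < 0)" using m by (simp add: mult_less_0_iff)
  then show ?thesis using r m unfolding puiseux_nth_of_fps laurent_root_def
    by (auto elim!: Ints_cases)
qed

end

lemma puiseux_eq_tpow_of_fps:
  assumes "x \<noteq> 0"
  obtains m f where "m > 0" "x = tpow (puiseux_val x) * of_fps m f" "f $ 0 = puiseux_lead x"
proof -
  obtain m f where m: "m > 0" and x: "puiseux_nth x = laurent_root m f" by (rule puiseux_common1)
  have f: "f \<noteq> 0"
    using assms by (auto simp: puiseux_nth_inject[symmetric] x zero_puiseux.rep_eq laurent_root_zero[of m])
  let ?d = "fls_subdegree f"
  have v: "puiseux_val x = of_int ?d / of_nat m"
    by (rule puiseux_val_laurent_root[OF m x f])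
  have "x = tpow (puiseux_val x) * of_fps m (fls_base_factor_to_fps f)"
  proof (rule puiseux_eqI)
    fix q
    have "(of_nat m * (q - of_int ?d / of_nat m) :: rat) = of_nat m * q - of_int ?d"
      using m by (simp add: algebra_simps)
    moreover have "(of_nat m * q - of_int ?d \<in> \<int>) = (of_nat m * q \<in> \<int>)"
      using Ints_add[of "of_nat m * q - of_int ?d" "of_int ?d"] by (auto intro: Ints_diff)
    ultimately show "puiseux_nth x q = puiseux_nth (tpow (puiseux_val x) * of_fps m (fls_base_factor_to_fps f)) q"
      unfolding puiseux_nth_tpow_mult puiseux_nth_of_fps[OF m] x v laurent_root_def
      by (auto simp: elim!: Ints_cases)
  qed
  moreover have "fls_base_factor_to_fps f $ 0 = puiseux_lead x"
    by (simp add: puiseux_lead_laurent_root[OF m x])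
  ultimately show thesis using m that by blast
qed

text \<open>Split off the leading power of \<open>t\<close>. Its exponent can be halved because all
  rational exponents are allowed, and the remaining power series has a positive constant term, hence
  a square root built from the real \<open>sqrt\<close>.\<close>

lemma puiseux_pos_is_square:
  assumes "x > (0::puiseux)"
  obtains y where "x = y * y" "y \<noteq> 0"
proof -
  obtain m f where m: "m > 0" and x: "x = tpow (puiseux_val x) * of_fps m f" and f0: "f $ 0 = puiseux_lead x"
    using assms by (elim puiseux_eq_tpow_of_fps[OF less_imp_neq[THEN not_sym]]) blast
  have pos: "f $ 0 > 0" using assms f0 by (simp add: less_puiseux_def)
  let ?g = "fps_radical (\<lambda>_. sqrt) (Suc 1) f"
  have "?g ^ Suc 1 = f"
    using power_radical[of f "\<lambda>_. sqrt" 1] pos by simp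
  then have "?g * ?g = f" by (simp add: power2_eq_square numeral_2_eq_2)
  then have "of_fps m f = of_fps m ?g * of_fps m ?g" by (metis of_fps_mult[OF m])
  moreover have "tpow (puiseux_val x) = tpow (puiseux_val x / 2) * tpow (puiseux_val x / 2)"
    by (simp flip: tpow_add)
  ultimately have "x = (tpow (puiseux_val x / 2) * of_fps m ?g) * (tpow (puiseux_val x / 2) * of_fps m ?g)"
    by (subst x) (simp add: mult_ac)
  then show thesis using that assms by force
qed

section \<open>Real constants, infinitesimals and common denominators\<close>

definition puiseux_of_real :: "real \<Rightarrow> puiseux" where
  "puiseux_of_real c = of_fps 1 (fps_const c)"

lemma puiseux_nth_of_real: "puiseux_nth (puiseux_of_real c) q = (if q = 0 then c else 0)"
  unfolding puiseux_of_real_def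
  by (auto simp: puiseux_nth_of_fps laurent_root_def elim!: Ints_cases)

lemma puiseux_of_real_0 [simp]: "puiseux_of_real 0 = 0"
  and puiseux_of_real_1 [simp]: "puiseux_of_real 1 = 1"
  and puiseux_of_real_add: "puiseux_of_real (a + b) = puiseux_of_real a + puiseux_of_real b"
  and puiseux_of_real_mult: "puiseux_of_real (a * b) = puiseux_of_real a * puiseux_of_real b"
  by (simp_all add: puiseux_of_real_def flip: of_fps_add of_fps_mult)

lemma puiseux_of_real_inj: "puiseux_of_real a = puiseux_of_real b \<longleftrightarrow> a = b"
  by (metis puiseux_nth_of_real)

text \<open>The real constant contributes the only term of exponent at most zero, so
  \<open>c - x\<close> and \<open>c + x\<close> both have leading coefficient
  \<open>c\<close>.\<close>

lemma infinitesimal_less: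
  assumes "\<And>q. q \<le> 0 \<Longrightarrow> puiseux_nth x q = 0" "c > 0"
  shows "\<bar>x\<bar> < puiseux_of_real c"
proof -
  have *: "y < puiseux_of_real c" if "\<And>q. q \<le> 0 \<Longrightarrow> puiseux_nth y q = 0" for y
  proof -
    have "puiseux_lead (puiseux_of_real c - y) = puiseux_nth (puiseux_of_real c - y) 0"
      using that assms by (intro puiseux_lead_eqI) (auto simp: minus_puiseux.rep_eq puiseux_nth_of_real)
    then show ?thesis using that assms by (simp add: less_puiseux_def minus_puiseux.rep_eq puiseux_nth_of_real)
  qed
  show ?thesis using *[of x] *[of "- x"] assms by (auto simp: abs_less_iff uminus_puiseux.rep_eq)
qed

lemma common_denominator:
  assumes "finite A"
  shows "\<exists>m>0. \<forall>i\<in>A. \<exists>g. puiseux_nth (c i) = laurent_root m g"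
  using assms
proof induction
  case (insert a A)
  then obtain m where m: "m > 0" "\<forall>i\<in>A. \<exists>g. puiseux_nth (c i) = laurent_root m g" by blast
  obtain k f where k: "k > 0" "puiseux_nth (c a) = laurent_root k f" by (rule puiseux_common1)
  show ?case
  proof (intro exI[of _ "m * k"] conjI ballI)
    fix i assume "i \<in> insert a A"
    then show "\<exists>g. puiseux_nth (c i) = laurent_root (m * k) g"
      using m k laurent_root_rescale[of m k] laurent_root_rescale[of k m]
      by (metis insertE mult.commute)
  qed (use m k in simp)
qed auto

text \<open>Without negative exponents, the Laurent series over the common denominator are power
  series. A single \<open>m\<close> for all coefficients lets Hensel lifting proceed along
  \<open>nat\<close>.\<close>

lemma common_denominator_fps:
  assumes "finite A" "\<And>i q. i \<in> A \<Longrightarrow> q < 0 \<Longrightarrow> puiseux_nth (c i) q = 0"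
  shows "\<exists>m>0. \<exists>g. \<forall>i\<in>A. c i = of_fps m (g i)"
proof -
  obtain m where m: "m > 0" "\<forall>i\<in>A. \<exists>g. puiseux_nth (c i) = laurent_root m g"
    using common_denominator[OF assms(1)] by blast
  have "\<exists>h. c i = of_fps m h" if i: "i \<in> A" for i
  proof -
    from m i obtain g where g: "puiseux_nth (c i) = laurent_root m g" by blast
    have "g $$ n = 0" if "n < 0" for n
      using assms(2)[OF i, of "of_int n / of_nat m"] that m(1)
      by (simp add: g laurent_root_def divide_neg_pos)
    then have "fls_subdegree g \<ge> 0"
      by (metis fls_zero_subdegree linorder_not_le nth_fls_subdegree_nonzero order_refl)
    then have "fps_to_fls (fls_regpart g) = g" by simp
    then show ?thesis
      using m(1) g by (metis puiseux_nth_of_fps puiseux_nth_inject)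
  qed
  then show ?thesis using m(1) by metis
qed

unbundle no fps_syntax and vec_syntax

section \<open>Hensel lifting of a factorization\<close>

text \<open>Multiplying the Bezout identity by \<open>r\<close> gives a solution, and reducing the
  multiplier of \<open>h\<close> modulo \<open>g\<close> bounds \<open>a\<close>. If
  \<open>b\<close> were too large, \<open>h * a\<close> could not cancel the top term of
  \<open>g * b\<close>, and \<open>r\<close> would reach degree
  \<open>degree g + degree h\<close>.\<close>

lemma bezout_degree:
  fixes g h r :: "'a::field poly"
  assumes uv: "u * g + v * h = 1" and "degree r < degree g + degree h" "g \<noteq> 0" "h \<noteq> 0"
    "degree g > 0" "degree h > 0"
  shows "\<exists>a b. g * b + h * a = r \<and> degree a < degree g \<and> degree b < degree h"
proof -
  define a where "a = (v * r) mod g"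
  define b where "b = (v * r) div g * h + u * r"
  have a: "a = v * r - (v * r) div g * g"
    by (simp add: a_def minus_div_mult_eq_mod)
  have "g * b + h * a = (u * g + v * h) * r" unfolding b_def a by (simp add: algebra_simps)
  then have eq: "g * b + h * a = r" by (simp add: uv)
  have da: "degree a < degree g"
    using degree_mod_less[of g "v * r"] assms by (auto simp: a_def)
  have "degree b < degree h"
  proof (rule ccontr)
    assume nb: "\<not> degree b < degree h"
    with assms have b: "b \<noteq> 0" by auto
    have "degree (h * a) \<le> degree h + degree a" by (rule degree_mult_le)
    also have "\<dots> < degree (g * b)" using nb da b assms by (simp add: degree_mult_eq)
    finally have "degree r = degree (g * b)"
      using eq by (metis degree_add_eq_left)
    then show False using assms nb b by (simp add: degree_mult_eq)
  qed
  with eq da show ?thesis by blast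
qed

context
  fixes F :: "nat \<Rightarrow> real poly" and g h :: "real poly"
begin

text \<open>Entry \<open>n\<close> is the pair of \<open>n\<close>-th coefficients of the two lifted
  factors, as series in \<open>t^(1/m)\<close>. In the \<open>n\<close>-th coefficient of their
  product, the summands of index \<open>0\<close> and \<open>n\<close> form the unknown part
  \<open>g * b + h * a\<close>; the sum over \<open>{1..<n}\<close> is already known.\<close>

function hensel_seq :: "nat \<Rightarrow> real poly \<times> real poly" where
  "hensel_seq n = (if n = 0 then (g, h) else
     (SOME (a, b). g * b + h * a = F n - (\<Sum>i\<in>{1..<n}. fst (hensel_seq i) * snd (hensel_seq (n - i)))
       \<and> degree a < degree g \<and> degree b < degree h))"
  by pat_completeness auto
termination by (relation "Wellfounded.measure id") auto

declare hensel_seq.simps [simp del]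

text \<open>By strong induction the earlier corrections keep the right-hand side below degree
  \<open>degree g + degree h\<close>, so the Bezout step is solvable and the choice by
  \<open>SOME\<close> meets its specification. The strict bound on \<open>F n\<close> for positive
  \<open>n\<close> says that the top coefficient does not vary with the series variable.\<close>

lemma hensel_seq_props:
  assumes "u * g + v * h = 1" "F 0 = g * h" "degree g > 0" "degree h > 0"
    "\<And>n. n > 0 \<Longrightarrow> degree (F n) < degree g + degree h"
  shows "n > 0 \<Longrightarrow> degree (fst (hensel_seq n)) < degree g \<and> degree (snd (hensel_seq n)) < degree h"
    and "(\<Sum>i\<le>n. fst (hensel_seq i) * snd (hensel_seq (n - i))) = F n"
proof -
  have nz: "g \<noteq> 0" "h \<noteq> 0" using assms by auto
  have h0: "hensel_seq 0 = (g, h)" by (simp add: hensel_seq.simps)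
  have *: "g * snd (hensel_seq n) + h * fst (hensel_seq n) =
        F n - (\<Sum>i\<in>{1..<n}. fst (hensel_seq i) * snd (hensel_seq (n - i)))
      \<and> degree (fst (hensel_seq n)) < degree g \<and> degree (snd (hensel_seq n)) < degree h" if "n > 0" for n
    using that
  proof (induction n rule: less_induct)
    case (less n)
    let ?r = "F n - (\<Sum>i\<in>{1..<n}. fst (hensel_seq i) * snd (hensel_seq (n - i)))"
    have "degree (fst (hensel_seq i) * snd (hensel_seq (n - i))) < degree g + degree h" if "i \<in> {1..<n}" for i
      using less.IH[of i] less.IH[of "n - i"] that degree_mult_le[of "fst (hensel_seq i)" "snd (hensel_seq (n - i))"]
      by simp
    then have "degree ?r < degree g + degree h"
      using assms less.prems by (intro degree_diff_less degree_sum_less) auto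
    from bezout_degree[OF assms(1) this nz assms(3,4)]
    have "\<exists>ab. case ab of (a, b) \<Rightarrow> g * b + h * a = ?r \<and> degree a < degree g \<and> degree b < degree h"
      by auto
    \<comment> \<open>Only the four occurrences of \<open>hensel_seq n\<close> are unfolded; the
      earlier entries inside the sum stay folded.\<close>
    from someI_ex[OF this] show ?case
      using less.prems by (subst (1 2 5 6) hensel_seq.simps) (simp add: case_prod_unfold)
  qed
  show "n > 0 \<Longrightarrow> degree (fst (hensel_seq n)) < degree g \<and> degree (snd (hensel_seq n)) < degree h"
    using * by blast
  show "(\<Sum>i\<le>n. fst (hensel_seq i) * snd (hensel_seq (n - i))) = F n"
  proof (cases "n = 0")
    case False
    have "{..n} = insert 0 (insert n {1..<n})" using False by auto
    then show ?thesis using *[of n] False by (simp add: h0 algebra_simps)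
  qed (simp add: h0 assms)
qed

end

text \<open>
  A power series in \<open>t\<^bsup>1/m\<^esup>\<close> whose coefficients \<open>F n\<close> are polynomials of degree at most \<open>N\<close>,
  read as a polynomial over the Puiseux series.
\<close>

definition poly_of_seq :: "nat \<Rightarrow> nat \<Rightarrow> (nat \<Rightarrow> real poly) \<Rightarrow> puiseux poly" where
  "poly_of_seq m N F = (\<Sum>i\<le>N. monom (of_fps m (Abs_fps (\<lambda>n. coeff (F n) i))) i)"

lemma coeff_poly_of_seq:
  assumes "m > 0" "\<And>n. degree (F n) \<le> N"
  shows "coeff (poly_of_seq m N F) i = of_fps m (Abs_fps (\<lambda>n. coeff (F n) i))"
proof (cases "i \<le> N")
  case True
  then show ?thesis by (simp add: poly_of_seq_def coeff_sum sum.delta' if_distrib cong: if_cong)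
next
  case False
  then have "coeff (F n) i = 0" for n using assms(2)[of n] by (intro coeff_eq_0) simp
  then have "Abs_fps (\<lambda>n. coeff (F n) i) = 0" by (simp add: fps_eq_iff)
  with False assms show ?thesis by (simp add: poly_of_seq_def coeff_sum)
qed

lemma poly_of_seq_mult:
  assumes m: "m > 0" and G: "\<And>n. degree (G n) \<le> M" and H: "\<And>n. degree (H n) \<le> N"
  shows "poly_of_seq m M G * poly_of_seq m N H = poly_of_seq m (M + N) (\<lambda>n. \<Sum>i\<le>n. G i * H (n - i))"
proof -
  have d: "degree (\<Sum>i\<le>n. G i * H (n - i)) \<le> M + N" for n
    using G H by (intro degree_sum_le) (auto intro: order.trans[OF degree_mult_le add_mono])
  have "Abs_fps (\<lambda>n. coeff (\<Sum>i\<le>n. G i * H (n - i)) k)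
    = (\<Sum>i\<le>k. Abs_fps (\<lambda>n. coeff (G n) i) * Abs_fps (\<lambda>n. coeff (H n) (k - i)))" for k
    by (rule fps_ext)
       (simp add: fps_sum_nth fps_mult_nth coeff_sum coeff_mult atLeast0AtMost sum.swap[of _ "{..k}"])
  then show ?thesis
    by (intro poly_eqI)
       (simp add: coeff_mult coeff_poly_of_seq[OF m G] coeff_poly_of_seq[OF m H] coeff_poly_of_seq[OF m d]
          of_fps_sum[OF m] of_fps_mult[OF m])
qed

text \<open>All corrections have lower degree than \<open>g\<close> and \<open>h\<close>, so the
  lifted factors do not exceed these degrees. As both are positive, both factors have degree below
  \<open>degree g + degree h\<close>.\<close>

theorem hensel_factorization:
  assumes m: "m > 0" and F0: "F 0 = g * h" and cop: "u * g + v * h = 1"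
    and dg: "degree g > 0" and dh: "degree h > 0"
    and F: "\<And>n. n > 0 \<Longrightarrow> degree (F n) < degree g + degree h"
  shows "\<exists>G H. poly_of_seq m (degree g + degree h) F = G * H \<and> degree G \<le> degree g \<and> degree H \<le> degree h"
proof -
  note props = hensel_seq_props[where F = F, OF cop F0 dg dh F]
  let ?G = "\<lambda>n. fst (hensel_seq F g h n)" and ?H = "\<lambda>n. snd (hensel_seq F g h n)"
  have G: "degree (?G n) \<le> degree g" and H: "degree (?H n) \<le> degree h" for n
    using props(1)[of n] by (cases "n = 0"; simp add: hensel_seq.simps[of _ _ _ 0])+
  have "poly_of_seq m (degree g) ?G * poly_of_seq m (degree h) ?H = poly_of_seq m (degree g + degree h) F"
    unfolding poly_of_seq_mult[OF m G H] by (simp add: props(2))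
  moreover have "degree (poly_of_seq m (degree g) ?G) \<le> degree g" "degree (poly_of_seq m (degree h) ?H) \<le> degree h"
    unfolding poly_of_seq_def by (auto intro!: degree_sum_le order.trans[OF degree_monom_le])
  ultimately show ?thesis by metis
qed

section \<open>Sums of squares\<close>

text \<open>Rule induction gives the closure properties; \<open>sos_imp_sum_squares\<close> converts
  back to the indexed sums of \<open>real_radical_of\<close>.\<close>

inductive sos :: "'a::comm_ring_1 \<Rightarrow> bool" where
  sos_0: "sos 0"
| sos_step: "sos a \<Longrightarrow> sos (a + x * x)"

lemma sos_square: "sos (x * x)"
  using sos_step[OF sos_0] by simp

lemma sos_1: "sos 1"
  using sos_square[of 1] by simp

lemma sos_add: "sos a \<Longrightarrow> sos b \<Longrightarrow> sos (a + b)"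
  by (rotate_tac, induction rule: sos.induct) (auto simp: add.assoc[symmetric] intro: sos_step)

lemma sos_mult_square: "sos a \<Longrightarrow> sos (x * x * a)"
proof (induction rule: sos.induct)
  case (sos_step a y)
  then show ?case using sos.sos_step[of "x * x * a" "x * y"] by (simp add: algebra_simps)
qed (simp add: sos_0)

lemma sos_mult: "sos a \<Longrightarrow> sos b \<Longrightarrow> sos (a * b)"
proof (induction rule: sos.induct)
  case (sos_step a x)
  then show ?case using sos_mult_square[of b x] by (simp add: distrib_right sos_add)
qed (simp add: sos_0)

lemma sos_sum: "(\<And>i. i \<in> A \<Longrightarrow> sos (f i)) \<Longrightarrow> sos (\<Sum>i\<in>A. f i)"
  by (induction A rule: infinite_finite_induct) (auto intro: sos_0 sos_add)

lemma sos_imp_sum_squares: "sos a \<Longrightarrow> \<exists>r. \<exists>G :: nat \<Rightarrow> _. a = (\<Sum>i<r. (G i)\<^sup>2)"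
proof (induction rule: sos.induct)
  case sos_0
  show ?case by (rule exI[of _ 0]) simp
next
  case (sos_step a x)
  then obtain r and G :: "nat \<Rightarrow> 'a" where a: "a = (\<Sum>i<r. (G i)\<^sup>2)" by blast
  show ?case
    by (rule exI[of _ "Suc r"], rule exI[of _ "G(r := x)"]) (simp add: a power2_eq_square)
qed

lemma sos_smult: "sos s \<Longrightarrow> sos (smult (c * c) s)"
  using sos_mult_square[of s "[:c:]"] by simp

lemma sos_const: "sos [:c * c:]"
  using sos_square[of "[:c:]"] by simp

lemma sos_monom: "sos (monom 1 (2 * i) :: 'a::comm_ring_1 poly)"
  using sos_square[of "monom 1 i"] by (simp add: mult_monom mult_2)

lemma sos_pcompose: "sos s \<Longrightarrow> sos (s \<circ>\<^sub>p q)"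
  by (induction rule: sos.induct) (simp_all add: pcompose_add pcompose_mult sos_0 sos_step)

text \<open>The multiple of all even powers up to the degree is a margin that a bare sum of squares
  would lack. The induction splits off the real quadratic factor of a conjugate pair of roots and
  multiplies the margins.\<close>

lemma real_poly_without_root:
  fixes p :: "real poly"
  assumes "lead_coeff p = 1" "\<And>x. poly p x \<noteq> 0"
  shows "\<exists>c e s. c > 0 \<and> sos s \<and> degree p = 2 * e \<and> p = smult c (\<Sum>i\<le>e. monom 1 (2 * i)) + s"
  using assms
proof (induction "degree p" arbitrary: p rule: less_induct)
  case less
  have p0: "p \<noteq> 0" using less.prems by auto
  show ?case
  proof (cases "degree p = 0")
    case True
    then have "p = 1" using less.prems by (metis degree_0_id one_pCons)
    then show ?thesis using True
      by (intro exI[of _ 1] exI[of _ 0] exI[of _ 0]) (simp add: sos_0)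
  next
    case False
    let ?q = "map_poly complex_of_real p"
    have "degree ?q \<noteq> 0" using False by (simp add: degree_map_poly)
    then have "\<not> constant (poly ?q)" by (simp add: constant_degree)
    then obtain z where z: "poly ?q z = 0" using fundamental_theorem_of_algebra by blast
    define a b where "a = Re z" and "b = Im z"
    have zab: "z = Complex a b" by (simp add: a_def b_def)
    \<comment> \<open>A real polynomial of degree at most one with a nonreal root is zero. Applied
      to the remainder modulo \<open>Q\<close>, this yields divisibility by
      \<open>Q\<close>.\<close>
    have ev: "poly (map_poly complex_of_real f) z = 0 \<Longrightarrow> degree f < 2 \<Longrightarrow> b \<noteq> 0 \<Longrightarrow> f = 0" for f
    proof -
      assume f: "poly (map_poly complex_of_real f) z = 0" "degree f < 2" "b \<noteq> 0"
      then obtain u v where "f = [:u, v:]"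
        by (metis degree_eq_zeroE degree_pCons_eq_if less_2_cases pCons_0_0 pCons_cases One_nat_def nat.inject)
      then show "f = 0" using f by (auto simp: map_poly_pCons zab complex_eq_iff)
    qed
    have evr: "poly (map_poly complex_of_real f) (of_real x) = of_real (poly f x)" for f x
      by (induction f) (simp_all add: map_poly_pCons)
    have b: "b \<noteq> 0"
    proof
      assume "b = 0"
      then have "z = complex_of_real a" by (simp add: zab complex_eq_iff)
      then have "poly p a = 0" using z
        by (metis of_real_eq_0_iff evr)
      then show False using less.prems by simp
    qed
    define Q where "Q = [:a * a + b * b, - 2 * a, 1:]"
    have Qz: "poly (map_poly complex_of_real Q) z = 0"
      by (simp add: Q_def map_poly_pCons zab complex_eq_iff algebra_simps)
    have hom: "map_poly complex_of_real (f * g) = map_poly complex_of_real f * map_poly complex_of_real g"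
        "map_poly complex_of_real (f + g) = map_poly complex_of_real f + map_poly complex_of_real g" for f g
      by (intro poly_eqI; simp add: coeff_map_poly coeff_mult)+
    have dQ: "degree Q = 2" "Q \<noteq> 0" "lead_coeff Q = 1" by (auto simp: Q_def)
    have "degree (p mod Q) < 2" using degree_mod_less[of Q p] dQ by auto
    moreover have "poly (map_poly complex_of_real (p mod Q)) z = 0"
      using z Qz hom[of "p div Q * Q"] hom(1)[of "p div Q" Q]
      by (metis add.left_neutral div_mult_mod_eq mult_zero_right poly_add poly_mult)
    ultimately have "p mod Q = 0" using ev b by blast
    then have pq: "p = p div Q * Q" by (metis add.right_neutral div_mult_mod_eq)
    define r where "r = p div Q"
    have r0: "r \<noteq> 0" using pq p0 by (auto simp: r_def)
    have dp: "degree p = degree r + 2" using pq r0 dQ by (metis r_def degree_mult_eq)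
    have "lead_coeff r = 1" using less.prems pq dQ by (metis lead_coeff_mult mult.right_neutral r_def)
    moreover have "poly r x \<noteq> 0" for x using less.prems pq by (metis mult_zero_left poly_mult r_def)
    ultimately obtain c e s where IH: "c > 0" "sos s" "degree r = 2 * e"
        "r = smult c (\<Sum>i\<le>e. monom 1 (2 * i)) + s"
      using less.hyps[of r] dp by auto
    \<comment> \<open>\<open>d\<close> is the margin of the quadratic factor. With this value the
      constant term of \<open>Q - d * (1 + X^2)\<close> is \<open>(a^2 + d^2) / (1 - d)\<close>, so
      completing the square leaves the nonnegative constant \<open>d^2 / (1 - d)\<close>.\<close>
    define d where "d = b * b / (1 + a * a + b * b)"
    have pos: "1 + a * a + b * b > 0" by (simp add: add_pos_nonneg)
    have "b * b > 0" using b by (auto simp: zero_less_mult_iff)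
    then have d: "d > 0" "d < 1" using pos by (auto simp: d_def add_pos_nonneg)
    have dd: "(1 - d) * (a * a + b * b - d) = a * a + d * d"
    proof -
      have "d * (1 + a * a + b * b) = b * b" using pos by (simp add: d_def)
      then show ?thesis by algebra
    qed
    define w where "w = sqrt (1 - d)"
    have w: "w * w = 1 - d" "w > 0" using d by (auto simp: w_def)
    define k where "k = sqrt (d * d / (1 - d))"
    have k: "k * k = d * d / (1 - d)" using d by (auto simp: k_def)
    have "Q = smult d (1 + monom 1 2) + ([:- a / w, w:] * [:- a / w, w:] + [:k * k:])"
    proof -
      have "a * a + b * b = d + (a * a / (w * w) + k * k)"
      proof -
        have "a * a + b * b - d = (a * a + d * d) / (1 - d)"
          using dd d by (simp add: eq_divide_eq mult.commute)
        then show ?thesis unfolding w k by (simp add: add_divide_distrib)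
      qed
      then show ?thesis using w by (simp add: Q_def monom_altdef power2_eq_square one_pCons)
    qed
    then obtain s' where Q: "Q = smult d (1 + monom 1 2) + s'" and s': "sos s'"
      using sos_add[OF sos_square sos_const] by blast
    \<comment> \<open>Multiplying \<open>S\<close> by \<open>1 + X^2\<close> produces every even
      power up to the new degree once, and the interior ones, collected in \<open>T\<close>, a
      second time.\<close>
    define S where "S = (\<Sum>i\<le>e. monom 1 (2 * i) :: real poly)"
    define T where "T = (\<Sum>i\<in>{1..e}. monom 1 (2 * i) :: real poly)"
    have "(1 + monom 1 2) * S = S + (\<Sum>i\<le>e. monom 1 (2 * Suc i))"
      by (simp add: S_def distrib_right sum_distrib_left mult_monom sum.distrib)
    also have "(\<Sum>i\<le>e. monom 1 (2 * Suc i)) = T + monom 1 (2 * Suc e)"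
      unfolding T_def atLeast0AtMost[symmetric] by (subst sum.shift_bounds_cl_Suc_ivl[symmetric]) simp
    finally have ST: "(1 + monom 1 2) * S = (\<Sum>i\<le>Suc e. monom 1 (2 * i)) + T"
      by (simp add: S_def)
    have sosS: "sos S" "sos T" "sos (monom 1 2 :: real poly)"
      using sos_monom[of 1, where 'a = real] by (auto simp: S_def T_def intro!: sos_sum sos_monom)
    have sm: "sos (smult x f)" if "x > 0" "sos f" for x and f :: "real poly"
      using sos_smult[OF that(2), of "sqrt x"] that(1) by simp
    have "p = smult (d * c) (\<Sum>i\<le>Suc e. monom 1 (2 * i))
        + (smult (d * c) T + smult d (1 + monom 1 2) * s + s' * (smult c S + s))"
    proof -
      have "p = (smult d (1 + monom 1 2) + s') * (smult c S + s)"
        using pq IH(4) Q by (simp add: r_def S_def mult.commute)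
      also have "\<dots> = smult (d * c) ((1 + monom 1 2) * S) + smult d (1 + monom 1 2) * s + s' * (smult c S + s)"
        by (simp add: algebra_simps smult_add_right)
      finally show ?thesis unfolding ST by (simp add: smult_add_right add_ac)
    qed
    moreover have "sos (smult (d * c) T + smult d (1 + monom 1 2) * s + s' * (smult c S + s))"
      using d IH s' sosS by (intro sos_add sos_mult sm sos_1) auto
    ultimately show ?thesis using d IH(1,3) dp
      by (intro exI[of _ "d * c"] exI[of _ "Suc e"]) auto
  qed
qed

lemma sos_puiseux_const: "c \<ge> 0 \<Longrightarrow> sos [:c :: puiseux:]"
  using sos_const sos_0 by (metis order.order_iff_strict pCons_0_0 puiseux_pos_is_square)

text \<open>Complete the square with \<open>k = r * r\<close>; the remaining constant
  \<open>k - d^2 / (4 * k)\<close> is nonnegative, hence zero or a square.\<close>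

lemma sos_puiseux_quadratic:
  fixes k d :: puiseux
  assumes "\<bar>d\<bar> < k"
  shows "sos [:k, d, k:]"
proof -
  have k: "k > 0" using assms by (meson abs_ge_zero le_less_trans)
  then obtain r where r: "k = r * r" "r \<noteq> 0" by (rule puiseux_pos_is_square)
  have "d * d < k * k" using assms k by (metis abs_ge_zero abs_mult_self_eq mult_strict_mono')
  also have "\<dots> \<le> 4 * k * k" using k by simp
  finally have "d * d / (4 * k) \<le> k" using k by (simp add: field_simps)
  then have "sos ([:d / (2 * r), r:] * [:d / (2 * r), r:] + [:k - d * d / (4 * k):])"
    by (intro sos_add sos_square sos_puiseux_const) simp
  also have "[:d / (2 * r), r:] * [:d / (2 * r), r:] + [:k - d * d / (4 * k):] = [:k, d, k:]"
    using r by (simp add: field_simps)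
  finally show ?thesis .
qed

text \<open>Of the four copies of \<open>k\<close> on an even power, one closes the quadratic
  \<open>[:k, d, k:]\<close> coming from below, one opens the next quadratic, one absorbs the
  perturbation of that power itself, and one is to spare. At the constant term no quadratic has to
  be closed, and that copy survives as \<open>[:k:]\<close>.\<close>

lemma sos_perturbation:
  fixes k :: puiseux
  assumes "\<And>j. \<bar>d j\<bar> < k"
  shows "\<exists>s. sos s \<and> smult (4 * k) (\<Sum>i<e. monom 1 (2 * i)) + monom k (2 * e) + (\<Sum>j<2 * e. monom (d j) j) = [:k:] + s"
proof (induction e)
  case 0
  show ?case by (rule exI[of _ 0]) (simp add: sos_0 monom_0)
next
  case (Suc e)
  then obtain s where s: "sos s"
    "smult (4 * k) (\<Sum>i<e. monom 1 (2 * i)) + monom k (2 * e) + (\<Sum>j<2 * e. monom (d j) j) = [:k:] + s" by blast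
  define s' where "s' = monom 1 (2 * e) * ([:k + d (2 * e):] + [:k:] + [:k, d (Suc (2 * e)), k:])"
  have "k > 0" using assms[of 0] by (meson abs_ge_zero le_less_trans)
  moreover have "k + d (2 * e) \<ge> 0" using assms[of "2 * e"] by (auto simp: abs_less_iff)
  ultimately have "sos s'"
    unfolding s'_def using assms by (intro sos_mult sos_add sos_monom sos_puiseux_const sos_puiseux_quadratic) auto
  have q: "[:k + d (2 * e):] + [:k:] + [:k, d (Suc (2 * e)), k:]
      = monom (3 * k + d (2 * e)) 0 + monom (d (Suc (2 * e))) 1 + monom k 2"
    by (simp add: monom_altdef power2_eq_square numeral_3_eq_3)
  have "s' = monom (3 * k + d (2 * e)) (2 * e) + monom (d (Suc (2 * e))) (Suc (2 * e)) + monom k (2 * Suc e)"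
    unfolding s'_def q by (simp add: mult_monom distrib_left)
  then have "smult (4 * k) (\<Sum>i<Suc e. monom 1 (2 * i)) + monom k (2 * Suc e) + (\<Sum>j<2 * Suc e. monom (d j) j)
    = (smult (4 * k) (\<Sum>i<e. monom 1 (2 * i)) + monom k (2 * e) + (\<Sum>j<2 * e. monom (d j) j)) + s'"
    by (simp add: smult_add_right smult_monom algebra_simps flip: add_monom) (simp add: add_monom)
  also have "\<dots> = [:k:] + (s + s')" by (simp add: s(2))
  finally show ?case using sos_add[OF s(1) \<open>sos s'\<close>] by blast
qed

section \<open>Univariate polynomials over the Puiseux series\<close>

text \<open>The polynomial \<open>w\<close> vanishes at \<open>a\<close>, so \<open>w ^ k\<close> is
  divisible by \<open>[:- a, 1:] ^ k\<close>, while \<open>1 - w ^ k\<close> is divisible by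
  \<open>1 - w\<close>, a multiple of \<open>h\<close>.\<close>

lemma linear_power_bezout:
  fixes h :: "'a::field poly"
  assumes "poly h a \<noteq> 0"
  shows "\<exists>u v. u * [:- a, 1:] ^ k + v * h = 1"
proof -
  define w where "w = 1 - smult (1 / poly h a) h"
  have "poly w a = 0" using assms by (simp add: w_def)
  then obtain q where "w = [:- a, 1:] * q" by (auto simp: poly_eq_0_iff_dvd)
  then have "w ^ k = q ^ k * [:- a, 1:] ^ k" by (metis power_mult_distrib mult.commute)
  moreover have "1 - w ^ k = (1 - w) * (\<Sum>i<k. w ^ i)" by (rule one_diff_power_eq)
  ultimately have "q ^ k * [:- a, 1:] ^ k + smult (1 / poly h a) (\<Sum>i<k. w ^ i) * h = 1"
    by (simp add: w_def algebra_simps)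
  then show ?thesis by blast
qed

text \<open>The nonzero constant \<open>u * u\<close> is what permits cancellation in a real radical
  ideal. The scalar \<open>c\<close> makes the property invariant under scaling, so that
  \<open>g\<close> can be normalized.\<close>

definition reducible_or_sos :: "puiseux poly \<Rightarrow> bool" where
  "reducible_or_sos g \<longleftrightarrow> (\<exists>a b. g = a * b \<and> degree a < degree g \<and> degree b < degree g) \<or>
     (\<exists>c u s. c \<noteq> 0 \<and> u \<noteq> 0 \<and> sos s \<and> smult c g = [:u * u:] + s)"

lemma reducible_or_sosI1:
  "g = a * b \<Longrightarrow> degree a < degree g \<Longrightarrow> degree b < degree g \<Longrightarrow> reducible_or_sos g"
  unfolding reducible_or_sos_def by blast

lemma reducible_or_sosI2:
  "smult c g = [:u * u:] + s \<Longrightarrow> c \<noteq> 0 \<Longrightarrow> u \<noteq> 0 \<Longrightarrow> sos s \<Longrightarrow> reducible_or_sos g"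
  unfolding reducible_or_sos_def by blast

lemma reducible_or_sos_cases [consumes 1, case_names reducible sos]:
  assumes "reducible_or_sos g"
  obtains a b where "g = a * b" "degree a < degree g" "degree b < degree g"
  | c u s where "smult c g = [:u * u:] + s" "c \<noteq> 0" "u \<noteq> 0" "sos s"
  using assms unfolding reducible_or_sos_def by blast

lemma reducible_or_sos_smult:
  assumes "reducible_or_sos (smult c g)" "c \<noteq> 0"
  shows "reducible_or_sos g"
  using assms(1)
proof (cases rule: reducible_or_sos_cases)
  case (reducible a b)
  have "smult (inverse c) (smult c g) = g" using assms(2) by simp
  then have g: "g = smult (inverse c) a * b" unfolding reducible(1) by simp
  show ?thesis by (rule reducible_or_sosI1[OF g]) (use reducible(2,3) assms(2) in auto)
next
  case (sos d u s)
  then show ?thesis using assms(2) by (intro reducible_or_sosI2[of "d * c" g u s]) auto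
qed

text \<open>An affine substitution is invertible and preserves degrees, products, constants and sums
  of squares. This covers both the shift and the rescaling of the variable.\<close>

lemma reducible_or_sos_pcompose:
  assumes "reducible_or_sos (g \<circ>\<^sub>p [:a, b:])" "b \<noteq> 0"
  shows "reducible_or_sos g"
proof -
  let ?l = "[:- a / b, 1 / b:]"
  have inv: "(g \<circ>\<^sub>p [:a, b:]) \<circ>\<^sub>p ?l = g"
    using assms(2) by (simp flip: pcompose_assoc add: pcompose_pCons)
  have deg: "degree (p \<circ>\<^sub>p ?l) = degree p" "degree (p \<circ>\<^sub>p [:a, b:]) = degree p" for p
    using assms(2) by (simp_all add: degree_pcompose)
  show ?thesis using assms(1)
  proof (cases rule: reducible_or_sos_cases)
    case (reducible p q)
    have g: "g = (p \<circ>\<^sub>p ?l) * (q \<circ>\<^sub>p ?l)" using inv reducible(1) by (metis pcompose_mult)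
    show ?thesis by (rule reducible_or_sosI1[OF g]) (use reducible(2,3) in \<open>simp_all only: deg\<close>)
  next
    case (sos c u s)
    then have g: "smult c g = [:u * u:] + s \<circ>\<^sub>p ?l"
      using inv by (metis pcompose_add pcompose_const pcompose_smult)
    show ?thesis by (rule reducible_or_sosI2[OF g]) (use sos in \<open>auto intro: sos_pcompose\<close>)
  qed
qed

text \<open>
  If the reduction modulo \<open>t\<close> has a real root, that root has multiplicity less than \<open>d\<close> by the
  condition on the coefficient \<open>d - 1\<close>, so Hensel's lemma gives a factorization. Otherwise the
  reduction is a positive sum of all even powers plus a sum of squares, which absorbs the
  infinitesimal remaining coefficients.
\<close>

lemma reducible_or_sos_integral:
  fixes f :: "puiseux poly"
  assumes d: "degree f = d" "d \<ge> 2" and lc: "lead_coeff f = 1"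
    and int: "\<And>i q. q < 0 \<Longrightarrow> puiseux_nth (coeff f i) q = 0"
    and sub: "coeff f (d - 1) = 0"
    and i0: "i0 < d" "puiseux_nth (coeff f i0) 0 \<noteq> 0"
  shows "reducible_or_sos f"
proof -
  \<comment> \<open>The reduction of \<open>f\<close> to the real residue field: the terms of
    exponent zero of the integral coefficients.\<close>
  define r where "r = map_poly (\<lambda>x. puiseux_nth x 0) f"
  have cr: "coeff r i = puiseux_nth (coeff f i) 0" for i
    unfolding r_def by (rule coeff_map_poly) (simp add: zero_puiseux.rep_eq)
  have rd: "coeff r d = 1" using lc d by (simp add: cr one_puiseux.rep_eq)
  have dr: "degree r = d"
    using rd d by (intro antisym degree_le le_degree) (auto simp: cr coeff_eq_0 zero_puiseux.rep_eq)
  have r0: "r \<noteq> 0" using rd by auto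
  show ?thesis
  proof (cases "\<exists>a. poly r a = 0")
    case False
    obtain c e s where c: "c > 0" and s: "sos s" and e: "degree r = 2 * e"
      and rs: "r = smult c (\<Sum>i\<le>e. monom 1 (2 * i)) + s"
      using real_poly_without_root[of r] False rd dr by auto
    let ?of = "map_poly puiseux_of_real"
    have hom: "?of (p * q) = ?of p * ?of q" "?of (p + q) = ?of p + ?of q" for p q
    proof -
      have s: "puiseux_of_real (\<Sum>i\<in>A. f i) = (\<Sum>i\<in>A. puiseux_of_real (f i))" for A :: "nat set" and f
        by (induction A rule: infinite_finite_induct) (simp_all add: puiseux_of_real_add)
      show "?of (p * q) = ?of p * ?of q" "?of (p + q) = ?of p + ?of q"
        by (intro poly_eqI; simp add: coeff_map_poly coeff_mult puiseux_of_real_add puiseux_of_real_mult s)+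
    qed
    have homsum: "?of (\<Sum>i\<in>A. f i) = (\<Sum>i\<in>A. ?of (f i))" for A :: "nat set" and f
      by (induction A rule: infinite_finite_induct) (simp_all add: hom)
    have sos': "sos (?of s)"
      using s by (induction rule: sos.induct) (simp_all add: hom sos_0 sos_step)
    \<comment> \<open>A quarter of the margin, because \<open>sos_perturbation\<close> spends four
      copies of \<open>k\<close> on each even power.\<close>
    define k where "k = puiseux_of_real (c / 4)"
    have k4: "puiseux_of_real c = 4 * k"
    proof -
      have "puiseux_of_real c = puiseux_of_real (c / 4 + c / 4 + (c / 4 + c / 4))" by simp
      also have "\<dots> = k + k + (k + k)" unfolding k_def puiseux_of_real_add ..
      finally show ?thesis by simp
    qed
    define \<delta> where "\<delta> j = coeff f j - puiseux_of_real (coeff r j)" for j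
    have small: "\<bar>\<delta> j\<bar> < k" for j
      unfolding k_def using c
      by (intro infinitesimal_less)
         (auto simp: \<delta>_def cr minus_puiseux.rep_eq puiseux_nth_of_real int)
    then obtain s' where s': "sos s'"
      "smult (4 * k) (\<Sum>i<e. monom 1 (2 * i)) + monom k (2 * e) + (\<Sum>j<2 * e. monom (\<delta> j) j) = [:k:] + s'"
      using sos_perturbation by blast
    have "k > 0" using small[of 0] by (meson abs_ge_zero le_less_trans)
    then obtain u where u: "k = u * u" "u \<noteq> 0" by (rule puiseux_pos_is_square)
    have "f = ?of r + (\<Sum>j<2 * e. monom (\<delta> j) j)"
    proof (rule poly_eqI)
      fix i
      have "\<delta> i = 0" if "i \<ge> 2 * e"
      proof (cases "i = 2 * e")
        case True
        then show ?thesis using e dr rd lc d by (simp add: \<delta>_def)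
      next
        case False
        then show ?thesis using that e dr d by (simp add: \<delta>_def coeff_eq_0)
      qed
      then show "coeff f i = coeff (?of r + (\<Sum>j<2 * e. monom (\<delta> j) j)) i"
        by (cases "i < 2 * e") (auto simp: coeff_map_poly coeff_sum \<delta>_def)
    qed
    also have "?of r = smult (4 * k) (\<Sum>i\<le>e. monom 1 (2 * i)) + ?of s"
      unfolding rs by (simp add: hom homsum map_poly_monom map_poly_smult puiseux_of_real_mult k4)
    also have "(\<Sum>i\<le>e. monom 1 (2 * i)) = (\<Sum>i<e. monom 1 (2 * i)) + monom (1::puiseux) (2 * e)"
      by (simp flip: lessThan_Suc_atMost)
    \<comment> \<open>At the top power \<open>sos_perturbation\<close> uses a single copy of
      \<open>k\<close>; the other three are kept as a sum of squares.\<close>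
    also have "smult (4 * k) \<dots> = smult (4 * k) (\<Sum>i<e. monom 1 (2 * i)) + monom k (2 * e)
        + smult 3 (smult (u * u) (monom 1 (2 * e)))"
      by (simp add: smult_add_right smult_monom add_monom flip: u(1))
    also have "\<dots> + ?of s + (\<Sum>j<2 * e. monom (\<delta> j) j)
      = [:k:] + (s' + (smult 3 (smult (u * u) (monom 1 (2 * e))) + ?of s))"
      using s'(2) by (simp add: algebra_simps)
    finally have f: "f = [:u * u:] + (s' + (smult 3 (smult (u * u) (monom 1 (2 * e))) + ?of s))"
      unfolding u(1) .
    have "sos (smult 3 (smult (u * u) (monom 1 (2 * e))))"
    proof -
      let ?m = "smult (u * u) (monom 1 (2 * e))"
      have "smult 3 ?m = ?m + ?m + ?m" by (simp flip: smult_add_left)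
      then show ?thesis by (simp only: sos_add sos_smult sos_monom)
    qed
    then have "sos (s' + (smult 3 (smult (u * u) (monom 1 (2 * e))) + ?of s))"
      by (intro sos_add s' sos')
    then show ?thesis
      using f u(2) by (intro reducible_or_sosI2[of 1 f u]) (simp_all)
  next
    case True
    then obtain a where a: "poly r a = 0" by blast
    obtain k h where h: "r = [:- a, 1:] ^ k * h" "\<not> [:- a, 1:] dvd h" and "k = order a r"
      using order_decomp[OF r0] by blast
    have ha: "poly h a \<noteq> 0" using h(2) by (simp add: poly_eq_0_iff_dvd)
    have k: "k > 0" using a r0 order_root \<open>k = order a r\<close> by blast
    have h0: "h \<noteq> 0" using h(1) r0 by auto
    have dk: "d = k + degree h"
    proof -
      have "degree r = degree ([:- a, 1:] ^ k) + degree h"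
        unfolding h(1) by (rule degree_mult_eq) (use h0 in auto)
      then show ?thesis by (simp add: dr degree_linear_power)
    qed
    have lh: "lead_coeff h = 1"
    proof -
      have "lead_coeff r = lead_coeff ([:- a, 1:] ^ k) * lead_coeff h"
        unfolding h(1) by (rule lead_coeff_mult)
      then show ?thesis using rd dr by (simp add: degree_linear_power coeff_linear_power)
    qed
    \<comment> \<open>Otherwise the reduction is \<open>(X - a)^d\<close>. The vanishing coefficient
      of index \<open>d - 1\<close> forces \<open>a = 0\<close>, and \<open>X^d\<close> contradicts
      the choice of \<open>i0\<close>.\<close>
    have dh: "degree h > 0"
    proof (rule ccontr)
      assume "\<not> degree h > 0"
      then have "h = 1" using lh by (metis degree_0_id gr0I one_pCons)
      then have rk: "r = [:- a, 1:] ^ d" using h(1) dk by simp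
      have "d choose (d - 1) = d" by (subst binomial_symmetric) (use d in auto)
      then have "coeff r (d - 1) = of_nat d * - a"
        using d coeff_linear_poly_power[of "d - 1" d "- a" 1] rk by simp
      then have "a = 0" using sub d by (simp add: cr zero_puiseux.rep_eq)
      then have "coeff r i0 = 0" using coeff_linear_poly_power[of i0 d "- a" 1] i0 rk by simp
      then show False using i0 cr by simp
    qed
    obtain u v where uv: "u * [:- a, 1:] ^ k + v * h = 1"
      using linear_power_bezout[OF ha] by blast
    obtain m g' where m: "m > 0" and g': "\<And>i. i \<le> d \<Longrightarrow> coeff f i = of_fps m (g' i)"
      using common_denominator_fps[of "{..d}" "coeff f"] int by auto
    \<comment> \<open>The top series is set to exactly \<open>1\<close>, and those beyond
      \<open>d\<close> to \<open>0\<close>. Hence for positive \<open>n\<close> the polynomial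
      \<open>F n\<close>, which collects the coefficients of \<open>t^(n/m)\<close> in
      \<open>f\<close>, has degree below \<open>d\<close>, as Hensel lifting requires.\<close>
    define g where "g = (\<lambda>i. if i = d then 1 else if i < d then g' i else 0)"
    have g: "coeff f i = of_fps m (g i)" for i
      using g'[of i] lc d m by (auto simp: g_def coeff_eq_0)
    define F where "F n = (\<Sum>i\<le>d. monom (fps_nth (g i) n) i)" for n
    have dF: "degree (F n) \<le> d" for n
      unfolding F_def by (auto intro!: degree_sum_le order.trans[OF degree_monom_le])
    have cF: "coeff (F n) i = fps_nth (g i) n" for n i
      by (auto simp: F_def coeff_sum sum.delta' g_def)
    have fF: "f = poly_of_seq m d F"
      by (rule poly_eqI) (simp add: coeff_poly_of_seq[OF m dF] cF g fps_nth_inverse)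
    have F0: "F 0 = [:- a, 1:] ^ k * h"
    proof -
      have "F 0 = r"
        by (rule poly_eqI) (simp add: cr g puiseux_nth_of_fps_nonpos[OF m] cF)
      then show ?thesis using h(1) by simp
    qed
    have Fn: "degree (F n) < d" if "n > 0" for n
    proof (rule ccontr)
      assume "\<not> degree (F n) < d"
      then have "degree (F n) = d" using dF[of n] by simp
      then show False using that d by (metis cF g_def fps_one_nth leading_coeff_0_iff degree_0 less_numeral_extra(3) not_numeral_le_zero)
    qed
    have "degree ([:- a, 1:] ^ k) + degree h = d" using dk by (simp add: degree_linear_power)
    with hensel_factorization[where F = F, OF m F0 uv _ dh] Fn k
    obtain G H where "f = G * H" "degree G \<le> k" "degree H \<le> degree h"
      unfolding fF by (auto simp: degree_linear_power)
    then show ?thesis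
      using dk dh k d by (intro reducible_or_sosI1[of _ G H]) auto
  qed
qed

text \<open>Used to remove the second highest coefficient of a monic polynomial by a shift of the
  variable. The induction follows the Horner form \<open>p = a + X * q\<close>.\<close>

lemma coeff_pcompose_shift:
  fixes p :: "'a::comm_ring_1 poly"
  assumes "degree p \<le> Suc n"
  shows "coeff (p \<circ>\<^sub>p [:c, 1:]) (Suc n) = coeff p (Suc n)
       \<and> coeff (p \<circ>\<^sub>p [:c, 1:]) n = coeff p n + of_nat (Suc n) * c * coeff p (Suc n)"
  using assms
proof (induction n arbitrary: p)
  case (0 p)
  obtain a q where p: "p = pCons a q" by (rule pCons_cases)
  then have "degree q = 0" using 0 by (auto split: if_splits)
  then obtain b where "q = [:b:]" by (rule degree_eq_zeroE)
  then show ?case by (simp add: p pcompose_pCons algebra_simps)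
next
  case (Suc n p)
  obtain a q where p: "p = pCons a q" by (rule pCons_cases)
  then have q: "degree q \<le> Suc n" using Suc.prems by (auto split: if_splits)
  have "degree (q \<circ>\<^sub>p [:c, 1:]) \<le> Suc n"
    using degree_pcompose_le[of q "[:c, 1:]"] q by simp
  then have "coeff (q \<circ>\<^sub>p [:c, 1:]) (Suc (Suc n)) = 0" by (intro coeff_eq_0) simp
  moreover have "coeff q (Suc (Suc n)) = 0" using q by (intro coeff_eq_0) simp
  ultimately show ?case using Suc.IH[OF q]
    by (simp add: p pcompose_pCons algebra_simps)
qed

text \<open>Reduction to the integral case: scaling makes the polynomial monic, a shift removes the
  second highest coefficient, and the variable is rescaled by a power of \<open>t\<close> read off
  the Newton polygon. If no lower coefficient remains, the polynomial is \<open>X^d\<close> and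
  factors.\<close>

theorem reducible_or_sos:
  fixes g :: "puiseux poly"
  assumes "degree g \<ge> 2"
  shows "reducible_or_sos g"
proof -
  define d where "d = degree g"
  have d: "d \<ge> 2" using assms by (simp add: d_def)
  obtain n where n: "d = Suc n" using d by (cases d) auto
  define g1 where "g1 = smult (inverse (lead_coeff g)) g"
  have lg: "lead_coeff g \<noteq> 0" using assms by auto
  have g1: "degree g1 = d" "coeff g1 d = 1" using lg by (simp_all add: g1_def d_def)
  define g2 where "g2 = g1 \<circ>\<^sub>p [:- coeff g1 n / of_nat d, 1:]"
  have g2: "degree g2 = d" "coeff g2 d = 1" "coeff g2 (d - 1) = 0"
    using coeff_pcompose_shift[of g1 n "- coeff g1 n / of_nat d"] g1 n d
    by (simp_all add: g2_def degree_pcompose del: of_nat_Suc)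
  have "reducible_or_sos g2"
  proof (cases "\<exists>i<d. coeff g2 i \<noteq> 0")
    case False
    then have "g2 = monom 1 d"
      using g2 by (intro poly_eqI) (metis coeff_eq_0 coeff_monom linorder_neqE_nat)
    then have m: "g2 = monom 1 1 * monom 1 n" by (simp add: mult_monom n)
    show ?thesis
      by (rule reducible_or_sosI1[OF m]) (use g2(1) n d in \<open>simp_all add: degree_monom_eq\<close>)
  next
    case True
    define N where "N = {i. i < d \<and> coeff g2 i \<noteq> 0}"
    \<comment> \<open>Up to sign, the slope of the segment joining the point of index
      \<open>i\<close> to the point of the leading term in the Newton polygon. Replacing
      \<open>X\<close> by \<open>t^q * X\<close> for the least such \<open>q\<close> and dividing by
      \<open>t^(q * d)\<close> makes all coefficients integral, and the one of index
      \<open>i0\<close> gets valuation zero.\<close>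
    define sl where "sl i = puiseux_val (coeff g2 i) / of_nat (d - i)" for i
    have N: "finite N" "N \<noteq> {}" using True by (auto simp: N_def)
    define q where "q = Min (sl ` N)"
    have "q \<in> sl ` N" unfolding q_def using N by (intro Min_in) auto
    then obtain i0 where i0: "i0 \<in> N" "q = sl i0" by auto
    have qle: "q * of_nat (d - i) \<le> puiseux_val (coeff g2 i)" if "i \<in> N" for i
    proof -
      have "q \<le> sl i" unfolding q_def using N that by simp
      then show ?thesis using that by (simp add: sl_def N_def field_simps)
    qed
    define g3 where "g3 = smult (tpow (- (q * of_nat d))) (g2 \<circ>\<^sub>p [:0, tpow q:])"
    have c3: "coeff g3 i = tpow (q * of_nat i - q * of_nat d) * coeff g2 i" for i
    proof -
      have "tpow (- (q * of_nat d)) * tpow q ^ i = tpow (q * of_nat i - q * of_nat d)"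
        unfolding tpow_power tpow_add[symmetric] by (simp add: algebra_simps)
      then show ?thesis unfolding g3_def coeff_smult coeff_pcompose_linear by (metis mult.assoc)
    qed
    have c3d: "coeff g3 d = 1" using g2 by (simp add: c3)
    have "degree g3 = d"
      using g2 by (simp add: g3_def degree_pcompose)
    moreover have "puiseux_nth (coeff g3 i) r = 0" if r: "r < 0" for i r
    proof -
      consider "i \<in> N" | "coeff g2 i = 0" | "i = d"
        using g2(1) coeff_eq_0[of g2 i] by (cases i d rule: linorder_cases) (auto simp: N_def)
      then show ?thesis
      proof cases
        case 1
        then have "r - (q * of_nat i - q * of_nat d) < puiseux_val (coeff g2 i)"
          using qle[OF 1] r by (simp add: N_def of_nat_diff algebra_simps)
        then show ?thesis by (simp add: c3 puiseux_nth_tpow_mult puiseux_nth_eq_0)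
      qed (use r c3d in \<open>auto simp: c3 zero_puiseux.rep_eq one_puiseux.rep_eq\<close>)
    qed
    moreover have "i0 < d" using i0 by (simp add: N_def)
    moreover have "puiseux_nth (coeff g3 i0) 0 \<noteq> 0"
    proof -
      have "0 - (q * of_nat i0 - q * of_nat d) = puiseux_val (coeff g2 i0)"
        using i0 by (simp add: sl_def N_def of_nat_diff field_simps)
      moreover have "puiseux_lead (coeff g2 i0) \<noteq> 0" using i0 by (simp add: N_def)
      ultimately show ?thesis by (simp add: c3 puiseux_nth_tpow_mult puiseux_lead_def)
    qed
    ultimately have "reducible_or_sos g3"
      using d c3d g2(3) by (intro reducible_or_sos_integral[of g3 d i0]) (auto simp: c3)
    then show ?thesis unfolding g3_def
      by (rule reducible_or_sos_pcompose[OF reducible_or_sos_smult]) auto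
  qed
  then have "reducible_or_sos g1" unfolding g2_def by (rule reducible_or_sos_pcompose) auto
  then show ?thesis unfolding g1_def by (rule reducible_or_sos_smult) (use lg in simp)
qed

section \<open>Real radical ideals of univariate polynomials\<close>

lemma real_radical_sos:
  assumes I: "is_ideal I" "real_radical I" and x: "x * x + s \<in> I" "sos s"
  shows "x \<in> I"
proof -
  obtain r and G :: "nat \<Rightarrow> 'a" where s: "s = (\<Sum>i<r. (G i)\<^sup>2)"
    using sos_imp_sum_squares[OF x(2)] by blast
  have "x ^ (2 * 1) + (\<Sum>i<r. (G i)\<^sup>2) \<in> I" using x(1) by (simp add: s power2_eq_square)
  then have "x \<in> real_radical_of I" unfolding real_radical_of_def by blast
  then show ?thesis using I(2) by (simp add: real_radical_def)
qed

text \<open>The cofactor \<open>h\<close> is arbitrary in the induction: when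
  \<open>g = a * b\<close>, one factor is treated while the other is carried along in
  \<open>h\<close>. Linear factors contribute a root to \<open>R\<close>, and factors bounded away
  from zero disappear.\<close>

lemma real_radical_split:
  fixes I :: "puiseux poly set"
  assumes I: "is_ideal I" "real_radical I" and "h * g \<in> I" "g \<noteq> 0"
  shows "\<exists>R. finite R \<and> h * (\<Prod>c\<in>R. [:- c, 1:]) \<in> I"
  using assms(3,4)
proof (induction "degree g" arbitrary: g h rule: less_induct)
  case less
  have mult: "c * x \<in> I" if "x \<in> I" for c x using I(1) that by (simp add: is_ideal_iff)
  \<comment> \<open>Multiplying once more by \<open>h\<close> turns the hypothesis into a square
    plus a sum of squares, \<open>(h * u)^2 + h^2 * s\<close>.\<close>
  have drop: "h \<in> I" if "h * [:u * u:] + s * h \<in> I" "u \<noteq> 0" "sos s" for u s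
  proof -
    have "(h * v) * (h * v) + h * h * s = h * (h * (v * v) + s * h)" for v
      by (simp add: algebra_simps)
    from this[of "[:u:]"] have "(h * [:u:]) * (h * [:u:]) + h * h * s = h * (h * [:u * u:] + s * h)"
      by simp
    then have "(h * [:u:]) * (h * [:u:]) + h * h * s \<in> I" using mult that(1) by simp
    then have "h * [:u:] \<in> I" by (rule real_radical_sos[OF I]) (rule sos_mult_square[OF that(3)])
    from mult[OF this, of "[:inverse u:]"] show ?thesis using that(2) by simp
  qed
  consider "degree g = 0" | "degree g = 1" | "degree g \<ge> 2" by linarith
  then show ?case
  proof cases
    case 1
    then obtain c where g: "g = [:c:]" "c \<noteq> 0" using less.prems by (metis degree_eq_zeroE pCons_0_0)
    from mult[OF less.prems(1), of "[:inverse c:]"] g show ?thesis by (intro exI[of _ "{}"]) simp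
  next
    case 2
    define a b where "a = coeff g 0" and "b = coeff g 1"
    have g: "g = [:a, b:]"
      by (rule poly_eqI) (use 2 in \<open>auto simp: a_def b_def coeff_pCons coeff_eq_0 split: nat.split\<close>)
    have b: "b \<noteq> 0" using 2 by (auto simp: g split: if_splits)
    have "[:inverse b:] * g = (\<Prod>c\<in>{- a / b}. [:- c, 1:])"
      using b by (simp add: g field_simps)
    then have "[:inverse b:] * (h * g) = h * (\<Prod>c\<in>{- a / b}. [:- c, 1:])"
      by (metis mult.left_commute)
    then show ?thesis using mult[OF less.prems(1), of "[:inverse b:]"] by (metis finite.emptyI finite.insertI)
  next
    case 3
    from reducible_or_sos[OF 3] show ?thesis
    proof (cases rule: reducible_or_sos_cases)
      case ab: (reducible a b)
      have "(h * a) * b \<in> I" using less.prems ab by (simp add: mult_ac)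
      then obtain R where R: "finite R" "(h * a) * (\<Prod>c\<in>R. [:- c, 1:]) \<in> I"
        using less.hyps[OF ab(3)] less.prems ab(1) by (metis mult_zero_right)
      then have "(h * (\<Prod>c\<in>R. [:- c, 1:])) * a \<in> I" by (simp add: mult_ac)
      then obtain T where T: "finite T" "(h * (\<Prod>c\<in>R. [:- c, 1:])) * (\<Prod>c\<in>T. [:- c, 1:]) \<in> I"
        using less.hyps[OF ab(2)] less.prems ab(1) by (metis mult_zero_left)
      \<comment> \<open>The sets \<open>R\<close> and \<open>T\<close> may share roots. Both
        products divide that over the union, so \<open>h * ?p * ?p\<close> lies in \<open>I\<close>;
        a further factor \<open>h\<close> makes it the square of \<open>h * ?p\<close>, and the real
        radical property removes the square.\<close>
      let ?p = "\<Prod>c\<in>R \<union> T. [:- c, 1:]"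
      have "(\<Prod>c\<in>R. [:- c, 1:]) dvd ?p" "(\<Prod>c\<in>T. [:- c, 1:]) dvd ?p"
        using R T by (auto intro!: prod_dvd_prod_subset)
      then have "h * (\<Prod>c\<in>R. [:- c, 1:]) * (\<Prod>c\<in>T. [:- c, 1:]) dvd h * ?p * ?p"
        by (intro mult_dvd_mono dvd_refl)
      then obtain z where z: "h * ?p * ?p = h * (\<Prod>c\<in>R. [:- c, 1:]) * (\<Prod>c\<in>T. [:- c, 1:]) * z"
        by (elim dvdE)
      have "h * ?p * ?p \<in> I" using mult[OF T(2), of z] unfolding z by (simp only: mult.commute)
      from mult[OF this, of h] have "(h * ?p) * (h * ?p) + 0 \<in> I" by (simp only: mult_ac add_0_right)
      then have "h * ?p \<in> I" using sos_0 by (rule real_radical_sos[OF I])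
      then show ?thesis using R T by blast
    next
      case *: (sos c u s)
      have "[:c:] * (h * g) = h * smult c g" by simp
      then have "[:c:] * (h * g) = h * [:u * u:] + s * h"
        unfolding *(1) by (simp add: distrib_left mult.commute)
      then have "h * [:u * u:] + s * h \<in> I" using mult[OF less.prems(1), of "[:c:]"] by simp
      then show ?thesis using drop * by (intro exI[of _ "{}"]) simp
    qed
  qed
qed

section \<open>Multivariate polynomials\<close>

definition Cst :: "puiseux \<Rightarrow> 'n kpoly" where
  "Cst c = Poly_Mapping.single 0 c"

definition Var :: "'n \<Rightarrow> 'n kpoly" where
  "Var k = Poly_Mapping.single (Poly_Mapping.single k 1) 1"

definition mono_eval :: "('n::finite \<Rightarrow>\<^sub>0 nat) \<Rightarrow> puiseux ^ 'n \<Rightarrow> puiseux" where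
  "mono_eval l x = (\<Prod>k\<in>UNIV. (x $ k) ^ Poly_Mapping.lookup l k)"

lemma poly_mapping_sum_singles:
  "F = (\<Sum>l\<in>Poly_Mapping.keys F. Poly_Mapping.single l (Poly_Mapping.lookup F l))"
  by (rule poly_mapping_eqI)
     (auto simp: lookup_sum lookup_single when_def sum.delta' in_keys_iff)

lemma times_poly_mapping_sum:
  fixes F G :: "'a::comm_monoid_add \<Rightarrow>\<^sub>0 'b::comm_semiring_1"
  shows "F * G = (\<Sum>l\<in>Poly_Mapping.keys F. \<Sum>l'\<in>Poly_Mapping.keys G.
    Poly_Mapping.single (l + l') (Poly_Mapping.lookup F l * Poly_Mapping.lookup G l'))"
proof -
  have "F * G = (\<Sum>l\<in>Poly_Mapping.keys F. Poly_Mapping.single l (Poly_Mapping.lookup F l))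
      * (\<Sum>l\<in>Poly_Mapping.keys G. Poly_Mapping.single l (Poly_Mapping.lookup G l))"
    by (metis poly_mapping_sum_singles)
  then show ?thesis by (simp add: sum_product mult_single)
qed

lemma Cst_0 [simp]: "Cst 0 = 0" and Cst_1 [simp]: "Cst 1 = 1"
  and Cst_add: "Cst (a + b) = Cst a + Cst b" and Cst_mult: "Cst (a * b) = Cst a * Cst b"
  by (simp_all add: Cst_def single_add mult_single)

lemma Cst_uminus: "Cst (- a) = - Cst a"
  by (simp add: Cst_def single_uminus)

lemma mono_eval_add: "mono_eval (l + l') x = mono_eval l x * mono_eval l' x"
  by (simp add: mono_eval_def lookup_add power_add prod.distrib)

lemma mono_eval_0 [simp]: "mono_eval 0 x = 1"
  by (simp add: mono_eval_def)

lemma poly_eval_superset: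
  "finite A \<Longrightarrow> Poly_Mapping.keys F \<subseteq> A \<Longrightarrow> poly_eval F x = (\<Sum>l\<in>A. Poly_Mapping.lookup F l * mono_eval l x)"
  unfolding poly_eval_def mono_eval_def
  by (intro sum.mono_neutral_left) (auto simp: in_keys_iff)

lemma poly_eval_0 [simp]: "poly_eval 0 x = 0"
  by (simp add: poly_eval_def)

lemma poly_eval_add: "poly_eval (F + G) x = poly_eval F x + poly_eval G x"
proof -
  let ?A = "Poly_Mapping.keys F \<union> Poly_Mapping.keys G"
  have "Poly_Mapping.keys (F + G) \<subseteq> ?A" by (rule keys_add)
  then show ?thesis
    by (simp add: poly_eval_superset[of ?A] lookup_add distrib_right sum.distrib)
qed

lemma poly_eval_single: "poly_eval (Poly_Mapping.single l c) x = c * mono_eval l x"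
  by (subst poly_eval_superset[of "{l}"]) auto

lemma poly_eval_sum: "poly_eval (\<Sum>i\<in>A. F i) x = (\<Sum>i\<in>A. poly_eval (F i) x)"
  by (induction A rule: infinite_finite_induct) (simp_all add: poly_eval_add)

lemma poly_eval_mult: "poly_eval (F * G) x = poly_eval F x * poly_eval G x"
proof -
  have "poly_eval (F * G) x = (\<Sum>l\<in>Poly_Mapping.keys F. \<Sum>l'\<in>Poly_Mapping.keys G.
      (Poly_Mapping.lookup F l * mono_eval l x) * (Poly_Mapping.lookup G l' * mono_eval l' x))"
    unfolding times_poly_mapping_sum[of F G]
    by (simp add: poly_eval_sum poly_eval_single mono_eval_add mult_ac)
  also have "\<dots> = poly_eval F x * poly_eval G x"
    by (simp add: poly_eval_superset[OF _ order_refl] sum_product)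
  finally show ?thesis .
qed

lemma poly_eval_Cst [simp]: "poly_eval (Cst c) x = c"
  by (simp add: Cst_def poly_eval_single)

lemma poly_eval_Var [simp]: "poly_eval (Var k) x = x $ k"
proof -
  have "mono_eval (Poly_Mapping.single k 1) x = (\<Prod>j\<in>UNIV. if j = k then x $ k else 1)"
    unfolding mono_eval_def by (intro prod.cong) (auto simp: lookup_single when_def)
  then show ?thesis by (simp add: Var_def poly_eval_single)
qed

lemma poly_eval_1 [simp]: "poly_eval 1 x = 1"
  using poly_eval_Cst[of 1 x] by simp

lemma poly_eval_diff: "poly_eval (F - G) x = poly_eval F x - poly_eval G x"
  using poly_eval_add[of "F - G" G x] by simp

lemma poly_eval_prod: "poly_eval (\<Prod>i\<in>A. F i) x = (\<Prod>i\<in>A. poly_eval (F i) x)"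
  by (induction A rule: infinite_finite_induct) (simp_all add: poly_eval_mult)

text \<open>Constants and variables generate the polynomial ring, so a congruence modulo an ideal
  can be checked on them.\<close>

lemma kpoly_induct [case_names Cst Var add mult]:
  fixes F :: "'n::finite kpoly"
  assumes Cst: "\<And>c. P (Cst c)" and Var: "\<And>k. P (Var k)"
    and add: "\<And>F G. P F \<Longrightarrow> P G \<Longrightarrow> P (F + G)" and mult: "\<And>F G. P F \<Longrightarrow> P G \<Longrightarrow> P (F * G)"
  shows "P F"
proof -
  have P1: "P 1" using Cst[of 1] by simp
  have "P (Poly_Mapping.single (Poly_Mapping.single k n) 1)" for k :: 'n and n
  proof (induction n)
    case (Suc n)
    have "Poly_Mapping.single (Poly_Mapping.single k (Suc n)) 1
        = Var k * Poly_Mapping.single (Poly_Mapping.single k n) 1"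
      by (simp add: Var_def mult_single flip: single_add)
    then show ?case using Suc mult Var by simp
  qed (use P1 in simp)
  moreover have "(\<Prod>k\<in>A. Poly_Mapping.single (f k) (1::puiseux)) = Poly_Mapping.single (\<Sum>k\<in>A. f k) 1"
    for A and f :: "'n \<Rightarrow> 'n \<Rightarrow>\<^sub>0 nat"
    by (induction A rule: infinite_finite_induct) (simp_all add: mult_single)
  moreover have "P (\<Prod>k\<in>A. f k)" if "\<And>k. P (f k)" for A :: "'n set" and f
    using that by (induction A rule: infinite_finite_induct) (auto intro: mult P1)
  moreover have "(\<Sum>k\<in>UNIV. Poly_Mapping.single k (Poly_Mapping.lookup l k)) = l" for l :: "'n \<Rightarrow>\<^sub>0 nat"
    by (rule poly_mapping_eqI) (simp add: lookup_sum lookup_single when_def sum.delta')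
  ultimately have P: "P (Poly_Mapping.single l 1)" for l by metis
  have "P (Poly_Mapping.single l c)" for l c
    using mult[OF Cst[of c] P[of l]] by (simp add: Cst_def mult_single)
  then have "P (\<Sum>l\<in>A. Poly_Mapping.single l (f l))" for A f
    using Cst[of 0] by (induction A rule: infinite_finite_induct) (auto intro: add)
  then show ?thesis by (metis poly_mapping_sum_singles)
qed

section \<open>Univariate polynomials inside the multivariate ring\<close>

definition uni :: "'n \<Rightarrow> puiseux poly \<Rightarrow> 'n kpoly" where
  "uni k p = poly (map_poly Cst p) (Var k)"

lemma uni_pCons: "uni k (pCons a p) = Cst a + Var k * uni k p"
  by (simp add: uni_def map_poly_pCons)

lemma uni_0 [simp]: "uni k 0 = 0" and uni_1 [simp]: "uni k 1 = 1"
  by (simp_all add: uni_def)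

lemma uni_add:
  fixes k :: 'n
  shows "uni k (p + q) = uni k p + uni k q"
proof -
  have "map_poly Cst (p + q) = map_poly Cst p + (map_poly Cst q :: 'n kpoly poly)"
    by (rule poly_eqI) (simp add: coeff_map_poly Cst_add)
  then show ?thesis by (simp add: uni_def)
qed

lemma uni_smult: "uni k (smult c p) = Cst c * uni k p"
  by (simp add: uni_def map_poly_smult Cst_mult)

lemma uni_mult: "uni k (p * q) = uni k p * uni k q"
  by (induction p) (simp_all add: uni_add uni_smult uni_pCons algebra_simps)

lemma uni_power: "uni k (p ^ n) = uni k p ^ n"
  by (induction n) (simp_all add: uni_mult)

lemma uni_sum: "uni k (\<Sum>i\<in>A. p i) = (\<Sum>i\<in>A. uni k (p i))"
  by (induction A rule: infinite_finite_induct) (simp_all add: uni_add)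

lemma uni_linear: "uni k [:- c, 1:] = Var k - Cst c"
  by (simp add: uni_pCons Cst_uminus)

lemma poly_eval_uni: "poly_eval (uni k p) x = poly p (x $ k)"
  by (induction p) (simp_all add: uni_pCons poly_eval_add poly_eval_mult)

section \<open>Zero-dimensional ideals\<close>

lemma is_ideal_0: "is_ideal I \<Longrightarrow> 0 \<in> I"
  and is_ideal_add: "is_ideal I \<Longrightarrow> x \<in> I \<Longrightarrow> y \<in> I \<Longrightarrow> x + y \<in> I"
  and is_ideal_mult: "is_ideal I \<Longrightarrow> x \<in> I \<Longrightarrow> c * x \<in> I"
  by (simp_all add: is_ideal_iff)

lemma is_ideal_uminus: "is_ideal I \<Longrightarrow> x \<in> I \<Longrightarrow> - x \<in> I"
  using is_ideal_mult[of I x "- 1"] by simp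

lemma is_ideal_diff: "is_ideal I \<Longrightarrow> x \<in> I \<Longrightarrow> y \<in> I \<Longrightarrow> x - y \<in> I"
  using is_ideal_add[of I x "- y"] is_ideal_uminus[of I y] by simp

lemma is_ideal_sum: "is_ideal I \<Longrightarrow> (\<And>i. i \<in> A \<Longrightarrow> f i \<in> I) \<Longrightarrow> (\<Sum>i\<in>A. f i) \<in> I"
  by (induction A rule: infinite_finite_induct) (auto intro: is_ideal_0 is_ideal_add)

lemma is_ideal_adjoin:
  assumes "is_ideal I"
  shows "is_ideal {x + c * a |x c. x \<in> I}"
  unfolding is_ideal_iff
proof (intro conjI ballI allI)
  show "0 \<in> {x + c * a |x c. x \<in> I}"
    using is_ideal_0[OF assms] by (auto intro!: exI[of _ 0])
next
  fix u v assume "u \<in> {x + c * a |x c. x \<in> I}" "v \<in> {x + c * a |x c. x \<in> I}"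
  then obtain x c y d where "u = x + c * a" "v = y + d * a" "x \<in> I" "y \<in> I" by blast
  moreover from this have "u + v = (x + y) + (c + d) * a" by (simp add: algebra_simps)
  ultimately show "u + v \<in> {x + c * a |x c. x \<in> I}"
    using is_ideal_add[OF assms] by blast
next
  fix d u assume "u \<in> {x + c * a |x c. x \<in> I}"
  then obtain x c where "u = x + c * a" "x \<in> I" by blast
  moreover from this have "d * u = d * x + (d * c) * a" by (simp add: algebra_simps)
  ultimately show "d * u \<in> {x + c * a |x c. x \<in> I}"
    using is_ideal_mult[OF assms] by blast
qed

text \<open>Krull's argument: by Zorn's lemma some ideal is maximal among those that contain
  \<open>I\<close> and avoid \<open>S\<close>. If it contained \<open>a * b\<close> but neither
  factor, adjoining each factor would give elements of \<open>S\<close> whose product lies in the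
  ideal.\<close>

lemma prime_ideal_disjoint:
  assumes I: "is_ideal I" and S: "1 \<in> S" "\<And>x y. x \<in> S \<Longrightarrow> y \<in> S \<Longrightarrow> x * y \<in> S" and "I \<inter> S = {}"
  shows "\<exists>P. is_prime_ideal P \<and> I \<subseteq> P \<and> P \<inter> S = {}"
proof -
  let ?A = "{J. is_ideal J \<and> I \<subseteq> J \<and> J \<inter> S = {}}"
  have "\<exists>M\<in>?A. \<forall>X\<in>?A. M \<subseteq> X \<longrightarrow> X = M"
  proof (rule subset_Zorn_nonempty)
    show "?A \<noteq> {}" using assms by blast
  next
    fix C assume C: "C \<noteq> {}" "subset.chain ?A C"
    have CA: "C \<subseteq> ?A" using C(2) by (simp add: subset.chain_def)
    have total: "X \<subseteq> Y \<or> Y \<subseteq> X" if "X \<in> C" "Y \<in> C" for X Y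
      using C(2) that by (auto simp: subset_chain_def)
    have "is_ideal (\<Union>C)"
      unfolding is_ideal_iff
    proof (intro conjI ballI allI)
      show "0 \<in> \<Union>C" using C CA is_ideal_0 by blast
    next
      fix x y assume "x \<in> \<Union>C" "y \<in> \<Union>C"
      then obtain X where "X \<in> C" "x \<in> X" "y \<in> X" using total by blast
      then show "x + y \<in> \<Union>C" using CA is_ideal_add by blast
    next
      fix c x assume "x \<in> \<Union>C"
      then show "c * x \<in> \<Union>C" using CA is_ideal_mult by blast
    qed
    then show "\<Union>C \<in> ?A" using C CA by blast
  qed
  then obtain P where P: "is_ideal P" "I \<subseteq> P" "P \<inter> S = {}"
    and max: "\<And>J. is_ideal J \<Longrightarrow> P \<subseteq> J \<Longrightarrow> J \<inter> S = {} \<Longrightarrow> J = P" by auto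
  have meet: "\<exists>x c. x \<in> P \<and> x + c * a \<in> S" if "a \<notin> P" for a
  proof (rule ccontr)
    assume no: "\<not> ?thesis"
    let ?J = "{x + c * a |x c. x \<in> P}"
    have "P \<subseteq> ?J" by (force intro: exI[of _ 0])
    then have "?J = P" using max[OF is_ideal_adjoin[OF P(1)]] no by blast
    moreover have "0 + 1 * a \<in> ?J" using is_ideal_0[OF P(1)] by blast
    ultimately show False using that by auto
  qed
  have "is_prime_ideal P"
    unfolding is_prime_ideal_def
  proof (intro conjI allI impI)
    show "P \<noteq> UNIV" using P(3) S(1) by blast
  next
    fix a b assume ab: "a * b \<in> P"
    show "a \<in> P \<or> b \<in> P"
    proof (rule ccontr)
      assume "\<not> ?thesis"
      then obtain x c y d where xy: "x \<in> P" "x + c * a \<in> S" "y \<in> P" "y + d * b \<in> S"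
        using meet[of a] meet[of b] by blast
      have "(x + c * a) * (y + d * b) = (y + d * b) * x + (c * a) * y + (c * d) * (a * b)"
        by (simp add: algebra_simps)
      also have "\<dots> \<in> P"
        by (rule is_ideal_add[OF P(1) is_ideal_add[OF P(1) is_ideal_mult[OF P(1) xy(1)]
              is_ideal_mult[OF P(1) xy(3)]] is_ideal_mult[OF P(1) ab]])
      finally show False using xy S(2) P(3) by blast
    qed
  qed (rule P(1))
  then show ?thesis using P by blast
qed

text \<open>If \<open>a\<close> were not a unit modulo \<open>P\<close>, the ideal generated by
  \<open>P\<close> and \<open>a\<close> would lie in a prime \<open>Q\<close>, and the chain
  \<open>P \<subset> Q\<close> would make the dimension at least one.\<close>

lemma zero_dimensional_prime_maximal:
  assumes "zero_dimensional I" and P: "is_prime_ideal P" "I \<subseteq> P" and a: "a \<notin> P"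
  shows "\<exists>u. 1 - u * a \<in> P"
proof (rule ccontr)
  assume no: "\<not> ?thesis"
  have PI: "is_ideal P" using P by (simp add: is_prime_ideal_def)
  let ?J = "{x + c * a |x c. x \<in> P}"
  have "1 \<notin> ?J"
  proof
    assume "1 \<in> ?J"
    then obtain x c where xc: "1 = x + c * a" "x \<in> P" by blast
    then have "1 - c * a = x" by (metis add_diff_cancel_right')
    with no xc show False by blast
  qed
  with prime_ideal_disjoint[OF is_ideal_adjoin[OF PI], of "{1}" a]
  obtain Q where Q: "is_prime_ideal Q" "?J \<subseteq> Q" by auto
  have PJ: "P \<subseteq> ?J" by (force intro: exI[of _ 0])
  have "0 + 1 * a \<in> ?J" using is_ideal_0[OF PI] by blast
  then have aJ: "a \<in> ?J" by simp
  have "P \<subset> Q" using PJ aJ Q(2) a by blast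
  then have chain: "(\<forall>i\<le>1. is_prime_ideal ((\<lambda>i. if i = 0 then P else Q) i) \<and> I \<subseteq> ((\<lambda>i. if i = 0 then P else Q) i))
      \<and> (\<forall>i<1. (\<lambda>i. if i = 0 then P else Q) i \<subset> (\<lambda>i. if i = 0 then P else Q) (Suc i))"
    using P Q(1) by auto
  have "ereal (real 1) \<le> ideal_dim I"
    unfolding ideal_dim_def
    by (rule Sup_upper, rule CollectI, rule exI[of _ 1], rule conjI, rule refl,
        rule exI[of _ "\<lambda>i. if i = 0 then P else Q"], rule chain)
  then show False using assms(1) by (simp add: zero_dimensional_def)
qed

interpretation kv: vector_space "\<lambda>c (F :: 'n kpoly). Cst c * F"
  by standard (simp_all add: Cst_add Cst_mult algebra_simps)

lemma finite_exponent_box: "finite {l :: 'n::finite \<Rightarrow>\<^sub>0 nat. \<forall>k. Poly_Mapping.lookup l k \<le> N}"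
proof -
  have "finite (PiE UNIV (\<lambda>_::'n. {..N}))" by (intro finite_PiE) auto
  then have "finite {f :: 'n \<Rightarrow> nat. \<forall>k. f k \<le> N}" by (rule rev_finite_subset) auto
  then have "finite (Poly_Mapping.lookup -` {f :: 'n \<Rightarrow> nat. \<forall>k. f k \<le> N})"
    by (rule finite_vimageI) (auto intro: injI poly_mapping_eqI)
  then show ?thesis by (simp add: vimage_def)
qed

text \<open>
  If the ideal contained no nonzero polynomial in \<open>x\<^sub>k\<close>, it would lie in a maximal ideal
  \<open>P\<close> with \<open>x\<^sub>k\<close> transcendental modulo \<open>P\<close>. The inverses of \<open>x\<^sub>k - c\<close>
  modulo \<open>P\<close>, for the uncountably many real \<open>c\<close>, are then linearly independent, although
  \<open>K[x]\<close> has countable dimension.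
\<close>

theorem zero_dimensional_univariate:
  fixes I :: "'n::finite kpoly set"
  assumes I: "is_ideal I" "zero_dimensional I"
  shows "\<exists>g. g \<noteq> 0 \<and> uni k g \<in> I"
proof (rule ccontr)
  assume no: "\<not> ?thesis"
  let ?S = "uni k ` {g. g \<noteq> 0} :: 'n kpoly set"
  have "1 \<in> ?S" by (rule image_eqI[of _ _ 1]) simp_all
  moreover have "x * y \<in> ?S" if "x \<in> ?S" "y \<in> ?S" for x y
  proof -
    from that obtain p q where "x = uni k p" "y = uni k q" "p \<noteq> 0" "q \<noteq> 0" by blast
    then show ?thesis by (intro image_eqI[of _ _ "p * q"]) (simp_all add: uni_mult)
  qed
  moreover have "I \<inter> ?S = {}" using no by blast
  ultimately have "\<exists>P. is_prime_ideal P \<and> I \<subseteq> P \<and> P \<inter> ?S = {}"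
    by (rule prime_ideal_disjoint[OF I(1)])
  then obtain P where P: "is_prime_ideal P" "I \<subseteq> P" "P \<inter> ?S = {}" by (elim exE conjE)
  have notin: "uni k g \<notin> P" if "g \<noteq> 0" for g
  proof
    assume "uni k g \<in> P"
    moreover have "uni k g \<in> ?S" using that by (intro imageI) simp
    ultimately have "uni k g \<in> P \<inter> ?S" by (rule IntI)
    then show False unfolding P(3) by (rule emptyE)
  qed
  have PI: "is_ideal P" using P(1) by (simp add: is_prime_ideal_def)
  have P1: "1 \<notin> P" using notin[of 1] by simp
  have "\<exists>u. 1 - u * (Var k - Cst (puiseux_of_real c)) \<in> P" for c
  proof (rule zero_dimensional_prime_maximal[OF I(2) P(1,2)])
    show "Var k - Cst (puiseux_of_real c) \<notin> P"
      using notin[of "[:- puiseux_of_real c, 1:]"] unfolding uni_linear by simp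
  qed
  then have "\<exists>u. \<forall>c. 1 - u c * (Var k - Cst (puiseux_of_real c)) \<in> P" by (intro choice) blast
  then obtain u where u: "\<And>c. 1 - u c * (Var k - Cst (puiseux_of_real c)) \<in> P" by blast
  define box where "box N = {l :: 'n \<Rightarrow>\<^sub>0 nat. \<forall>k. Poly_Mapping.lookup l k \<le> N}" for N
  have fin_box: "finite (box N)" for N unfolding box_def by (rule finite_exponent_box)
  have "\<exists>N. Poly_Mapping.keys F \<subseteq> box N" for F :: "'n kpoly"
  proof -
    let ?T = "(\<lambda>(l, k). Poly_Mapping.lookup l k) ` (Poly_Mapping.keys F \<times> (UNIV :: 'n set))"
    have "finite ?T" by simp
    then have "\<forall>l\<in>Poly_Mapping.keys F. \<forall>k. Poly_Mapping.lookup l k \<le> Max ?T" by (auto intro!: Max_ge)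
    then show ?thesis by (auto simp: box_def)
  qed
  then have "(UNIV :: real set) = (\<Union>N. {c. Poly_Mapping.keys (u c) \<subseteq> box N})" by blast
  moreover have "uncountable (UNIV :: real set)" by (rule uncountable_UNIV_real)
  \<comment> \<open>Uncountably many \<open>c\<close> are distributed over countably many
    finite-dimensional spaces, so one space contains \<open>u c\<close> for infinitely many
    \<open>c\<close>. One more of these than its dimension suffices for a linear relation.\<close>
  ultimately have "\<exists>N. infinite {c. Poly_Mapping.keys (u c) \<subseteq> box N}"
    using countable_UN[of "UNIV :: nat set" "\<lambda>N. {c. Poly_Mapping.keys (u c) \<subseteq> box N}"]
    by (auto dest: countable_finite)
  then obtain N where "infinite {c. Poly_Mapping.keys (u c) \<subseteq> box N}" ..
  from infinite_arbitrarily_large[OF this, of "Suc (card (box N))"]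
  obtain T where T: "T \<subseteq> {c. Poly_Mapping.keys (u c) \<subseteq> box N}" "finite T" "card T = Suc (card (box N))"
    by blast
  \<comment> \<open>Equality of \<open>u c\<close> and \<open>u d\<close> would put
    \<open>u c * (d - c)\<close> into \<open>P\<close>, hence \<open>u c\<close>, hence
    \<open>1\<close>.\<close>
  have inj: "inj_on u T"
  proof (rule inj_onI, rule ccontr)
    fix c d assume "u c = u d" "c \<noteq> d"
    let ?e = "puiseux_of_real d - puiseux_of_real c"
    have e: "?e \<noteq> 0" using \<open>c \<noteq> d\<close> puiseux_of_real_inj by simp
    have "(1 - u d * (Var k - Cst (puiseux_of_real d))) - (1 - u c * (Var k - Cst (puiseux_of_real c)))
        = u c * Cst ?e"
      using \<open>u c = u d\<close> by (simp add: Cst_def single_diff algebra_simps)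
    then have "u c * Cst ?e \<in> P" using is_ideal_diff[OF PI u u] by metis
    from is_ideal_mult[OF PI this, of "Cst (inverse ?e)"] have "u c \<in> P"
      using e by (simp add: Cst_mult[symmetric] mult.left_commute)
    then have "1 \<in> P"
      using is_ideal_add[OF PI u[of c] is_ideal_mult[OF PI, of "u c" "Var k - Cst (puiseux_of_real c)"]]
      \<open>u c \<in> P\<close> by (simp add: mult.commute)
    with P1 show False ..
  qed
  let ?B = "(\<lambda>l. Poly_Mapping.single l 1) ` box N :: 'n kpoly set"
  have "u c \<in> kv.span ?B" if "c \<in> T" for c
  proof -
    have "u c = (\<Sum>l\<in>Poly_Mapping.keys (u c). Cst (Poly_Mapping.lookup (u c) l) * Poly_Mapping.single l 1)"
      by (subst poly_mapping_sum_singles) (simp add: Cst_def mult_single)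
    also have "\<dots> \<in> kv.span ?B"
      using that T(1) by (intro kv.span_sum kv.span_scale kv.span_base) auto
    finally show ?thesis .
  qed
  then have "kv.dependent (u ` T)"
    using kv.independent_span_bound[of ?B "u ` T"] T(3) card_image[OF inj] card_image_le[OF fin_box, of "\<lambda>l. Poly_Mapping.single l (1::puiseux)" N] fin_box
    by fastforce
  then obtain w v where w: "v \<in> u ` T" "w v \<noteq> 0" "(\<Sum>v\<in>u ` T. Cst (w v) * v) = 0"
    using T(2) by (auto simp: kv.dependent_finite)
  then obtain c0 where c0: "c0 \<in> T" "w (u c0) \<noteq> 0" by blast
  have sum0: "(\<Sum>c\<in>T. Cst (w (u c)) * u c) = 0"
    using w(3) by (simp add: sum.reindex[OF inj])
  \<comment> \<open>Denominators are cleared in the linear relation: modulo \<open>P\<close>,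
    \<open>u c\<close> times the product of all the linear polynomials is \<open>q c\<close> in the
    variable \<open>k\<close>, so \<open>uni k g\<close> lies in \<open>P\<close>. At the real point
    \<open>c0\<close> all summands of \<open>g\<close> but one vanish, so \<open>g\<close> is
    nonzero.\<close>
  define q where "q c = (\<Prod>d\<in>T - {c}. [:- puiseux_of_real d, 1:])" for c
  define g where "g = (\<Sum>c\<in>T. smult (w (u c)) (q c))"
  have "poly g (puiseux_of_real c0) = (\<Sum>c\<in>T. w (u c) * poly (q c) (puiseux_of_real c0))"
    by (simp add: g_def poly_sum)
  also have "\<dots> = (\<Sum>c\<in>T. if c = c0 then w (u c0) * poly (q c0) (puiseux_of_real c0) else 0)"
    using c0 T(2) by (intro sum.cong) (auto simp: q_def poly_prod)
  also have "\<dots> = w (u c0) * poly (q c0) (puiseux_of_real c0)" using c0 T(2) by simp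
  also have "\<dots> \<noteq> 0" using c0 T(2) by (auto simp: q_def poly_prod puiseux_of_real_inj)
  finally have "g \<noteq> 0" by auto
  have "uni k g = (\<Sum>c\<in>T. Cst (w (u c)) * uni k (q c))"
    by (simp add: g_def uni_sum uni_smult)
  also have "\<dots> = (\<Sum>c\<in>T. Cst (w (u c)) * uni k (q c) * (1 - u c * (Var k - Cst (puiseux_of_real c))))
      + (\<Sum>c\<in>T. uni k (\<Prod>d\<in>T. [:- puiseux_of_real d, 1:]) * (Cst (w (u c)) * u c))"
  proof -
    have "uni k (\<Prod>d\<in>T. [:- puiseux_of_real d, 1:]) = (Var k - Cst (puiseux_of_real c)) * uni k (q c)"
      if "c \<in> T" for c
      unfolding uni_linear[symmetric] uni_mult[symmetric] q_def using that T(2)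
      by (subst prod.remove[of T c]) auto
    moreover have "a * p = a * p * (1 - v * l) + (l * p) * (a * v)" for a p v l :: "'n kpoly"
      by (simp add: algebra_simps)
    ultimately show ?thesis
      unfolding sum.distrib[symmetric] by (intro sum.cong refl) metis
  qed
  also have "(\<Sum>c\<in>T. uni k (\<Prod>d\<in>T. [:- puiseux_of_real d, 1:]) * (Cst (w (u c)) * u c)) = 0"
    using sum0 by (simp flip: sum_distrib_left)
  also have "(\<Sum>c\<in>T. Cst (w (u c)) * uni k (q c) * (1 - u c * (Var k - Cst (puiseux_of_real c)))) + 0 \<in> P"
    using u PI by (simp, intro is_ideal_sum is_ideal_mult) auto
  finally show False using notin[OF \<open>g \<noteq> 0\<close>] by contradiction
qed

text \<open>The contraction of \<open>I\<close> along the ring homomorphism \<open>uni k\<close> is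
  again a real radical ideal, so the univariate splitting applies with \<open>h = 1\<close>.\<close>

lemma real_radical_univariate:
  fixes I :: "'n::finite kpoly set"
  assumes I: "is_ideal I" "real_radical I" "zero_dimensional I"
  shows "\<exists>R. finite R \<and> uni k (\<Prod>c\<in>R. [:- c, 1:]) \<in> I"
proof -
  let ?J = "{p. uni k p \<in> I}"
  have J: "is_ideal ?J" using I(1) by (auto simp: is_ideal_iff uni_add uni_mult)
  have "real_radical_of ?J \<subseteq> ?J"
  proof
    fix p assume "p \<in> real_radical_of ?J"
    then obtain m r and G :: "nat \<Rightarrow> puiseux poly" where m: "m > 0" "uni k (p ^ (2 * m) + (\<Sum>i<r. (G i)\<^sup>2)) \<in> I"
      unfolding real_radical_of_def by blast
    then have mem: "uni k p ^ (2 * m) + (\<Sum>i<r. (uni k (G i))\<^sup>2) \<in> I"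
      by (simp add: uni_add uni_sum uni_power)
    have "uni k p \<in> real_radical_of I"
      unfolding real_radical_of_def
      by (rule CollectI, rule exI[of _ m], rule conjI[OF m(1)], rule exI[of _ r],
          rule exI[of _ "\<lambda>i. uni k (G i)"], rule mem)
    then show "p \<in> ?J" using I(2) by (simp add: real_radical_def)
  qed
  moreover have "?J \<subseteq> real_radical_of ?J"
  proof
    fix p assume "p \<in> ?J"
    then have mem: "p ^ (2 * 1) + (\<Sum>i<0. (0::puiseux poly)\<^sup>2) \<in> ?J"
      using is_ideal_mult[OF J, of p p] by (simp add: power2_eq_square)
    show "p \<in> real_radical_of ?J"
      unfolding real_radical_of_def
      by (rule CollectI, rule exI[of _ 1], rule conjI[OF zero_less_one], rule exI[of _ 0],
          rule exI[of _ "\<lambda>_. 0"], rule mem)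
  qed
  ultimately have JR: "real_radical ?J" by (auto simp: real_radical_def)
  obtain g where "g \<noteq> 0" "uni k g \<in> I" using zero_dimensional_univariate[OF I(1,3)] by blast
  then show ?thesis using real_radical_split[OF J JR, of 1 g] by auto
qed

section \<open>Ideals containing a grid\<close>

lemma is_ideal_gen: "is_ideal (ideal_gen B)"
  and ideal_gen_superset: "b \<in> B \<Longrightarrow> b \<in> ideal_gen B"
  and ideal_gen_minimal: "is_ideal I \<Longrightarrow> B \<subseteq> I \<Longrightarrow> ideal_gen B \<subseteq> I"
  unfolding is_ideal_def ideal_gen_def
  by (rule module.subspace_span[OF module_times] module.span_base[OF module_times]
      module.span_minimal[OF module_times], assumption?)+

definition lagrange :: "puiseux set \<Rightarrow> puiseux \<Rightarrow> puiseux poly" where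
  "lagrange R c = smult (inverse (\<Prod>d\<in>R - {c}. c - d)) (\<Prod>d\<in>R - {c}. [:- d, 1:])"

text \<open>Both sides agree on \<open>R\<close> and have degree below \<open>card R\<close>; for
  the constant \<open>1\<close> this needs \<open>R\<close> to be nonempty.\<close>

lemma sum_lagrange:
  assumes R: "finite R" "R \<noteq> {}"
  shows "(\<Sum>c\<in>R. lagrange R c) = 1"
proof (rule poly_eqI_degree[of R])
  fix x assume x: "x \<in> R"
  have "poly (lagrange R c) x = (if c = x then 1 else 0)" if "c \<in> R" for c
  proof (cases "c = x")
    case True
    then show ?thesis using R by (simp add: lagrange_def poly_prod)
  next
    case False
    then have "x \<in> R - {c}" using x by simp
    then show ?thesis using R False by (auto simp: lagrange_def poly_prod)
  qed
  then show "poly (\<Sum>c\<in>R. lagrange R c) x = poly 1 x"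
    using R x by (simp add: poly_sum)
next
  have "degree (lagrange R c) < card R" if "c \<in> R" for c
  proof -
    have "degree (lagrange R c) \<le> degree (\<Prod>d\<in>R - {c}. [:- d, 1:])"
      unfolding lagrange_def by (rule degree_smult_le)
    also have "\<dots> \<le> (\<Sum>d\<in>R - {c}. degree [:- d, 1:])" using R degree_prod_sum_le[of "R - {c}" "\<lambda>d. [:- d, 1:]"] by (simp add: o_def)
    also have "\<dots> = card R - 1" using that R by simp
    finally show ?thesis using R by (metis Suc_pred' card_gt_0_iff le_imp_less_Suc)
  qed
  then show "degree (\<Sum>c\<in>R. lagrange R c) < card R"
    using R by (intro degree_sum_less) auto
  show "degree 1 < card R" using R by (simp add: card_gt_0_iff)
qed

definition grid :: "('n::finite \<Rightarrow> puiseux set) \<Rightarrow> (puiseux ^ 'n) set" where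
  "grid R = {s. \<forall>k. s $ k \<in> R k}"

lemma grid_eq: "grid R = vec_lambda ` PiE UNIV R"
proof (intro equalityI subsetI)
  fix s assume "s \<in> grid R"
  then show "s \<in> vec_lambda ` PiE UNIV R"
    by (intro image_eqI[of _ _ "vec_nth s"]) (auto simp: grid_def)
qed (auto simp: grid_def PiE_iff)

lemma finite_grid: "(\<And>k. finite (R k)) \<Longrightarrow> finite (grid R)"
  unfolding grid_eq by (intro finite_imageI finite_PiE) auto

definition grid_poly :: "('n::finite \<Rightarrow> puiseux set) \<Rightarrow> puiseux ^ 'n \<Rightarrow> 'n kpoly" where
  "grid_poly R s = (\<Prod>k\<in>UNIV. uni k (lagrange (R k) (s $ k)))"

text \<open>The product over all variables of the one-variable partitions of unity, multiplied
  out.\<close>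

lemma sum_grid_poly:
  assumes R: "\<And>k. finite (R k)" "\<And>k. R k \<noteq> {}"
  shows "(\<Sum>s\<in>grid R. grid_poly R s) = 1"
proof -
  have "1 = (\<Prod>k\<in>UNIV. \<Sum>c\<in>R k. uni k (lagrange (R k) c))"
    by (simp add: sum_lagrange R flip: uni_sum)
  also have "\<dots> = (\<Sum>g\<in>PiE UNIV R. \<Prod>k\<in>UNIV. uni k (lagrange (R k) (g k)))"
    using R by (intro prod_sum_PiE) auto
  also have "\<dots> = (\<Sum>s\<in>grid R. grid_poly R s)"
    unfolding grid_eq by (subst sum.reindex) (auto simp: grid_poly_def intro!: inj_onI)
  finally show ?thesis ..
qed

text \<open>Modulo \<open>J\<close>, multiplying \<open>grid_poly R s\<close> by \<open>F\<close>
  amounts to evaluating \<open>F\<close> at \<open>s\<close>. For a variable, the difference to its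
  value supplies the missing factor of the Lagrange polynomial and produces a multiple of the given
  member of \<open>J\<close>; sums and products inherit the property.\<close>

lemma grid_poly_eval:
  fixes F :: "'n::finite kpoly"
  assumes J: "is_ideal J" and f: "\<And>k. uni k (\<Prod>c\<in>R k. [:- c, 1:]) \<in> J"
    and R: "\<And>k. finite (R k)" and s: "s \<in> grid R"
  shows "F * grid_poly R s - Cst (poly_eval F s) * grid_poly R s \<in> J"
proof (induction F rule: kpoly_induct)
  case (Cst c)
  then show ?case using is_ideal_0[OF J] by simp
next
  case (Var k)
  let ?e = "inverse (\<Prod>d\<in>R k - {s $ k}. s $ k - d)"
  define rest where "rest = (\<Prod>j\<in>UNIV - {k}. uni j (lagrange (R j) (s $ j)))"
  have L: "grid_poly R s = uni k (lagrange (R k) (s $ k)) * rest"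
    unfolding grid_poly_def rest_def by (rule prod.remove) auto
  have "[:- (s $ k), 1:] * lagrange (R k) (s $ k) = smult ?e (\<Prod>c\<in>R k. [:- c, 1:])"
    using s R by (subst prod.remove[of "R k" "s $ k"]) (auto simp: lagrange_def grid_def)
  then have *: "(Var k - Cst (s $ k)) * uni k (lagrange (R k) (s $ k)) = Cst ?e * uni k (\<Prod>c\<in>R k. [:- c, 1:])"
    unfolding uni_linear[symmetric] uni_smult[symmetric] uni_mult[symmetric] by simp
  have "Var k * grid_poly R s - Cst (s $ k) * grid_poly R s
      = rest * ((Var k - Cst (s $ k)) * uni k (lagrange (R k) (s $ k)))"
    unfolding L by (simp add: algebra_simps)
  then have "Var k * grid_poly R s - Cst (s $ k) * grid_poly R s
      = (rest * Cst ?e) * uni k (\<Prod>c\<in>R k. [:- c, 1:])"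
    unfolding * by (simp only: mult.assoc)
  then show ?case using is_ideal_mult[OF J f] by simp
next
  case (add F G)
  then show ?case using is_ideal_add[OF J add] by (simp add: poly_eval_add Cst_add algebra_simps)
next
  case (mult F G)
  let ?L = "grid_poly R s"
  have "F * G * ?L - Cst (poly_eval (F * G) s) * ?L
    = F * (G * ?L - Cst (poly_eval G s) * ?L) + Cst (poly_eval G s) * (F * ?L - Cst (poly_eval F s) * ?L)"
    by (simp add: poly_eval_mult Cst_mult algebra_simps)
  then show ?case using is_ideal_add[OF J is_ideal_mult[OF J mult(2)] is_ideal_mult[OF J mult(1)]] by metis
qed

text \<open>As the grid polynomials sum to \<open>1\<close>, \<open>F\<close> is the sum of the
  \<open>F * grid_poly R s\<close>. For \<open>s\<close> outside the variety the grid polynomial is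
  itself a generator; for \<open>s\<close> in the variety the summand is congruent to
  \<open>F(s)\<close> times it, that is, to zero.\<close>

theorem real_radical_zero_dimensional:
  fixes I :: "'n::finite kpoly set"
  assumes I: "is_ideal I" "real_radical I" "zero_dimensional I"
  obtains B where "finite B" "B \<subseteq> I" "finite (variety I)"
    "\<And>F. (\<And>x. x \<in> variety I \<Longrightarrow> poly_eval F x = 0) \<Longrightarrow> F \<in> ideal_gen B"
proof -
  have "\<forall>k. \<exists>R. finite R \<and> uni k (\<Prod>c\<in>R. [:- c, 1:]) \<in> I"
    using real_radical_univariate[OF I] by blast
  then obtain R0 where R0: "\<And>k. finite (R0 k)" "\<And>k. uni k (\<Prod>c\<in>R0 k. [:- c, 1:]) \<in> I" by metis
  \<comment> \<open>The set \<open>R0 k\<close> may be empty, whereas interpolation needs a point.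
    Inserting the root \<open>0\<close> replaces the polynomial by a multiple, which is still in
    \<open>I\<close>.\<close>
  define R where "R k = insert 0 (R0 k)" for k
  have R: "finite (R k)" "R k \<noteq> {}" for k using R0 by (auto simp: R_def)
  define f where "f k = uni k (\<Prod>c\<in>R k. [:- c, 1:])" for k
  have f: "f k \<in> I" for k
  proof -
    have "(\<Prod>c\<in>R k. [:- c, 1:]) = (\<Prod>c\<in>R k - R0 k. [:- c, 1:]) * (\<Prod>c\<in>R0 k. [:- c, 1:])"
      using R R0 by (intro prod.subset_diff) (auto simp: R_def)
    then show ?thesis unfolding f_def using is_ideal_mult[OF I(1) R0(2)] by (simp add: uni_mult)
  qed
  have sub: "variety I \<subseteq> grid R"
  proof
    fix x assume x: "x \<in> variety I"
    have "x $ k \<in> R k" for k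
    proof -
      have "poly_eval (f k) x = 0" using x f by (simp add: variety_def)
      then show ?thesis using R by (auto simp: f_def poly_eval_uni poly_prod)
    qed
    then show "x \<in> grid R" by (simp add: grid_def)
  qed
  define B where "B = range f \<union> grid_poly R ` (grid R - variety I)"
  have fin: "finite (grid R)" using R(1) by (rule finite_grid)
  \<comment> \<open>Some \<open>G\<close> in \<open>I\<close> does not vanish at \<open>s\<close>,
    and \<open>G * grid_poly R s\<close> is congruent to a nonzero constant times
    \<open>grid_poly R s\<close>.\<close>
  have "grid_poly R s \<in> I" if s: "s \<in> grid R" "s \<notin> variety I" for s
  proof -
    obtain G where G: "G \<in> I" "poly_eval G s \<noteq> 0" using s by (auto simp: variety_def)
    have "G * grid_poly R s - Cst (poly_eval G s) * grid_poly R s \<in> I"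
      using f unfolding f_def by (rule grid_poly_eval[OF I(1) _ R(1) s(1)])
    moreover have "G * grid_poly R s \<in> I" using is_ideal_mult[OF I(1) G(1)] by (metis mult.commute)
    ultimately have "Cst (poly_eval G s) * grid_poly R s \<in> I"
      using is_ideal_diff[OF I(1)] by (metis diff_diff_eq2 add_diff_cancel_left')
    from is_ideal_mult[OF I(1) this, of "Cst (inverse (poly_eval G s))"] show ?thesis
      using G(2) by (simp add: mult.assoc[symmetric] flip: Cst_mult)
  qed
  then have "B \<subseteq> I" using f by (auto simp: B_def)
  moreover have "F \<in> ideal_gen B" if F: "\<And>x. x \<in> variety I \<Longrightarrow> poly_eval F x = 0" for F
  proof -
    have fB: "f k \<in> ideal_gen B" for k by (rule ideal_gen_superset) (simp add: B_def)
    have "F * grid_poly R s \<in> ideal_gen B" if s: "s \<in> grid R" for s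
    proof (cases "s \<in> variety I")
      case True
      have "F * grid_poly R s - Cst (poly_eval F s) * grid_poly R s \<in> ideal_gen B"
        using fB unfolding f_def by (rule grid_poly_eval[OF is_ideal_gen _ R(1) s])
      then show ?thesis using F[OF True] by simp
    next
      case False
      then show ?thesis using s by (intro is_ideal_mult[OF is_ideal_gen] ideal_gen_superset) (simp add: B_def)
    qed
    then have "(\<Sum>s\<in>grid R. F * grid_poly R s) \<in> ideal_gen B" by (rule is_ideal_sum[OF is_ideal_gen])
    also have "(\<Sum>s\<in>grid R. F * grid_poly R s) = F"
      using sum_grid_poly[of R] R by (simp flip: sum_distrib_left)
    finally show ?thesis .
  qed
  moreover have "finite B" using fin by (simp add: B_def)
  moreover have "finite (variety I)" using sub fin by (rule finite_subset)
  ultimately show thesis using that by blast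
qed

section \<open>Leading terms\<close>

text \<open>The bound \<open>r\<close> is real because tropical points have real coordinates, and it
  need not be an exponent. The weak inequality includes zero and makes the property closed under
  sums; \<open>lead_at\<close> adds that level \<open>r\<close> is attained, which survives adding
  terms that satisfy \<open>lead_ge\<close> since equal signs cannot cancel.\<close>

definition lead_ge :: "real \<Rightarrow> real \<Rightarrow> puiseux \<Rightarrow> bool" where
  "lead_ge r s z \<longleftrightarrow> (\<forall>q. real_of_rat q < r \<longrightarrow> puiseux_nth z q = 0)
     \<and> (\<forall>q. real_of_rat q = r \<longrightarrow> s * puiseux_nth z q \<ge> 0)"

definition lead_at :: "real \<Rightarrow> real \<Rightarrow> puiseux \<Rightarrow> bool" where
  "lead_at r s z \<longleftrightarrow> lead_ge r s z \<and> (\<exists>q. real_of_rat q = r \<and> s * puiseux_nth z q > 0)"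

lemma lead_at_imp_ge: "lead_at r s z \<Longrightarrow> lead_ge r s z"
  by (simp add: lead_at_def)

lemma lead_ge_0: "lead_ge r s 0"
  by (simp add: lead_ge_def zero_puiseux.rep_eq)

lemma lead_at_nz: "lead_at r s z \<Longrightarrow> z \<noteq> 0"
  by (auto simp: lead_at_def zero_puiseux.rep_eq)

lemma lead_ge_add: "lead_ge r s y \<Longrightarrow> lead_ge r s z \<Longrightarrow> lead_ge r s (y + z)"
  by (auto simp: lead_ge_def plus_puiseux.rep_eq distrib_left)

lemma lead_at_add: "lead_at r s y \<Longrightarrow> lead_ge r s z \<Longrightarrow> lead_at r s (y + z)"
  using lead_ge_add[of r s y z]
  by (auto simp: lead_at_def lead_ge_def plus_puiseux.rep_eq distrib_left intro: add_pos_nonneg)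

lemma lead_ge_sum: "(\<And>i. i \<in> A \<Longrightarrow> lead_ge r s (f i)) \<Longrightarrow> lead_ge r s (\<Sum>i\<in>A. f i)"
  by (induction A rule: infinite_finite_induct) (auto intro: lead_ge_0 lead_ge_add)

lemma lead_at_sum:
  assumes "finite A" "a \<in> A" "lead_at r s (f a)" "\<And>i. i \<in> A \<Longrightarrow> lead_ge r s (f i)"
  shows "lead_at r s (\<Sum>i\<in>A. f i)"
proof -
  have "lead_at r s (f a + (\<Sum>i\<in>A - {a}. f i))"
    using assms by (intro lead_at_add lead_ge_sum) auto
  then show ?thesis using assms by (simp add: sum.remove)
qed

lemma puiseux_val_mult:
  assumes "x \<noteq> 0" "y \<noteq> 0"
  shows "puiseux_val (x * y) = puiseux_val x + puiseux_val y"
proof -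
  obtain m f g where m: "m > 0" and x: "puiseux_nth x = laurent_root m f"
    and y: "puiseux_nth y = laurent_root m g"
    by (rule puiseux_common2)
  have xy: "puiseux_nth (x * y) = laurent_root m (f * g)"
    by (simp add: times_puiseux.rep_eq x y laurent_root_mult[OF m])
  have "f \<noteq> 0" "g \<noteq> 0"
    using assms by (auto simp: puiseux_nth_inject[symmetric] x y zero_puiseux.rep_eq laurent_root_zero[of m])
  then show ?thesis
    using m by (simp add: puiseux_val_laurent_root[OF m x] puiseux_val_laurent_root[OF m y]
        puiseux_val_laurent_root[OF m xy] add_divide_distrib)
qed

lemma puiseux_sign_eq: "x \<noteq> 0 \<Longrightarrow> puiseux_sign x = sgn (puiseux_lead x)"
  using puiseux_lead_eq_0_iff[of x] by (auto simp: puiseux_sign_def less_puiseux_def sgn_if simp del: puiseux_lead_eq_0_iff)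

lemma puiseux_sign_mult: "x \<noteq> 0 \<Longrightarrow> y \<noteq> 0 \<Longrightarrow> puiseux_sign (x * y) = puiseux_sign x * puiseux_sign y"
  by (simp add: puiseux_sign_eq puiseux_lead_mult sgn_mult)

lemma puiseux_sign_cases: "puiseux_sign x = 1 \<or> puiseux_sign x = - 1"
  by (simp add: puiseux_sign_def)

lemma puiseux_nth_val_sign: "x \<noteq> 0 \<Longrightarrow> puiseux_sign x * puiseux_nth x (puiseux_val x) > 0"
  using puiseux_lead_eq_0_iff[of x]
  by (auto simp: puiseux_sign_eq puiseux_lead_def[symmetric] sgn_if simp del: puiseux_lead_eq_0_iff)

lemma lead_at_iff:
  assumes "z \<noteq> 0" "s = 1 \<or> s = - 1"
  shows "lead_at r s z \<longleftrightarrow> r = real_of_rat (puiseux_val z) \<and> s = puiseux_sign z"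
proof
  assume at: "lead_at r s z"
  then obtain q where q: "real_of_rat q = r" "s * puiseux_nth z q > 0" by (auto simp: lead_at_def)
  have "\<not> puiseux_val z < q"
  proof
    assume "puiseux_val z < q"
    then have "real_of_rat (puiseux_val z) < r" by (simp add: q(1)[symmetric] of_rat_less)
    then have "puiseux_nth z (puiseux_val z) = 0" using at by (auto simp: lead_at_def lead_ge_def)
    then show False using puiseux_nth_val_sign[OF assms(1)] by simp
  qed
  moreover have "\<not> q < puiseux_val z" using puiseux_nth_eq_0[of q z] q(2) by auto
  ultimately have "q = puiseux_val z" by simp
  then show "r = real_of_rat (puiseux_val z) \<and> s = puiseux_sign z"
    using q puiseux_nth_val_sign[OF assms(1)] assms(2) puiseux_sign_cases[of z] by auto
next
  assume r: "r = real_of_rat (puiseux_val z) \<and> s = puiseux_sign z"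
  then show "lead_at r s z"
    using puiseux_nth_val_sign[OF assms(1)]
    by (auto simp: lead_at_def lead_ge_def of_rat_less puiseux_nth_eq_0 intro: less_imp_le)
qed

lemma lead_ge_cases:
  assumes "lead_ge r s z" "s = 1 \<or> s = - 1"
  shows "z = 0 \<or> r < real_of_rat (puiseux_val z) \<or> lead_at r s z"
proof (rule ccontr)
  assume no: "\<not> ?thesis"
  then have nz: "puiseux_nth z (puiseux_val z) \<noteq> 0" using puiseux_nth_val_sign[of z] by auto
  then have "\<not> real_of_rat (puiseux_val z) < r" using assms(1) by (auto simp: lead_ge_def)
  then have "real_of_rat (puiseux_val z) = r" using no by simp
  then have "s * puiseux_nth z (puiseux_val z) > 0"
    using assms nz by (auto simp: lead_ge_def less_le)
  then show False using no assms(1) \<open>real_of_rat (puiseux_val z) = r\<close> by (auto simp: lead_at_def)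
qed

lemma lead_ge_greater: "r < real_of_rat (puiseux_val z) \<Longrightarrow> lead_ge r s z"
proof -
  assume r: "r < real_of_rat (puiseux_val z)"
  have "puiseux_nth z q = 0" if "real_of_rat q \<le> r" for q
    using r that by (intro puiseux_nth_eq_0) (simp flip: of_rat_less[where 'a = real])
  then show ?thesis by (auto simp: lead_ge_def)
qed

lemma lead_at_mult:
  assumes "lead_at r s y" "lead_at r' s' z" "s = 1 \<or> s = - 1" "s' = 1 \<or> s' = - 1"
  shows "lead_at (r + r') (s * s') (y * z)"
proof -
  have nz: "y \<noteq> 0" "z \<noteq> 0" using assms by (auto dest: lead_at_nz)
  have "s * s' = 1 \<or> s * s' = - 1" using assms by auto
  then show ?thesis
    using assms nz by (simp add: lead_at_iff puiseux_val_mult puiseux_sign_mult of_rat_add)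
qed

text \<open>If one factor exceeds its bound strictly, so does the product, and no sign condition
  remains. Otherwise both bounds are attained and the signs of the leading terms multiply.\<close>

lemma lead_ge_mult:
  assumes "lead_ge r s y" "lead_ge r' s' z" "s = 1 \<or> s = - 1" "s' = 1 \<or> s' = - 1"
  shows "lead_ge (r + r') (s * s') (y * z)"
proof (cases "y = 0 \<or> z = 0")
  case False
  have y: "r < real_of_rat (puiseux_val y) \<or> lead_at r s y" "r \<le> real_of_rat (puiseux_val y)"
    using lead_ge_cases[OF assms(1,3)] False lead_at_iff[of y s r] assms by auto
  have z: "r' < real_of_rat (puiseux_val z) \<or> lead_at r' s' z" "r' \<le> real_of_rat (puiseux_val z)"
    using lead_ge_cases[OF assms(2,4)] False lead_at_iff[of z s' r'] assms by auto
  show ?thesis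
  proof (cases "lead_at r s y \<and> lead_at r' s' z")
    case True
    then show ?thesis using lead_at_mult assms lead_at_imp_ge by blast
  next
    case at: False
    then have "r + r' < real_of_rat (puiseux_val (y * z))"
      using y z False by (auto simp: puiseux_val_mult of_rat_add)
    then show ?thesis by (rule lead_ge_greater)
  qed
qed (auto simp: lead_ge_0)

section \<open>Polynomials without sign change on the initial form\<close>

text \<open>Together with \<open>expt_sign\<close>, the part of weight and sign of a term that comes
  from its monomial. Separated from the coefficient, it is additive, respectively multiplicative, in
  the exponent.\<close>

definition expt_height :: "(real \<times> real) ^ 'n \<Rightarrow> ('n::finite \<Rightarrow>\<^sub>0 nat) \<Rightarrow> real" where
  "expt_height p l = (\<Sum>k\<in>UNIV. real (Poly_Mapping.lookup l k) * snd (p $ k))"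

definition expt_sign :: "(real \<times> real) ^ 'n \<Rightarrow> ('n::finite \<Rightarrow>\<^sub>0 nat) \<Rightarrow> real" where
  "expt_sign p l = (\<Prod>k\<in>UNIV. fst (p $ k) ^ Poly_Mapping.lookup l k)"

lemma expt_height_add: "expt_height p (l + l') = expt_height p l + expt_height p l'"
  by (simp add: expt_height_def lookup_add distrib_right sum.distrib)

lemma expt_sign_add: "expt_sign p (l + l') = expt_sign p l * expt_sign p l'"
  by (simp add: expt_sign_def lookup_add power_add prod.distrib)

lemma sign_power: "(x::real) = 1 \<or> x = - 1 \<Longrightarrow> x ^ n = 1 \<or> x ^ n = - 1"
  by (induction n) auto

lemma expt_sign_cases:
  assumes "p \<in> TRn"
  shows "expt_sign p l = 1 \<or> expt_sign p l = - 1"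
proof -
  have "(\<Prod>k\<in>A. fst (p $ k) ^ Poly_Mapping.lookup l k) \<in> {1, - 1}" for A
  proof (induction A rule: infinite_finite_induct)
    case (insert k A)
    have "fst (p $ k) = 1 \<or> fst (p $ k) = - 1" using assms by (auto simp: TRn_def TR_def mem_Times_iff)
    then show ?case using insert sign_power[of "fst (p $ k)"] by fastforce
  qed auto
  then show ?thesis by (auto simp: expt_sign_def)
qed

text \<open>Here \<open>w\<close> is the minimal weight and \<open>s\<close> the common sign. A
  monomial sign is its own inverse, so a term has sign \<open>s\<close> exactly if its coefficient
  has sign \<open>s * expt_sign p l\<close>. Zero coefficients satisfy every \<open>lead_ge\<close>,
  so all exponents can be quantified over.\<close>

definition pure :: "(real \<times> real) ^ 'n \<Rightarrow> 'n::finite kpoly \<Rightarrow> bool" where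
  "pure p F \<longleftrightarrow> (\<exists>w s. (s = 1 \<or> s = - 1)
     \<and> (\<forall>l. lead_ge (w - expt_height p l) (s * expt_sign p l) (Poly_Mapping.lookup F l))
     \<and> (\<exists>l. lead_at (w - expt_height p l) (s * expt_sign p l) (Poly_Mapping.lookup F l)))"

lemma trop_weight_eq: "trop_weight F p l = real_of_rat (puiseux_val (Poly_Mapping.lookup F l)) + expt_height p l"
  by (simp add: trop_weight_def expt_height_def)

lemma trop_sign_eq: "trop_sign F p l = puiseux_sign (Poly_Mapping.lookup F l) * expt_sign p l"
  by (simp add: trop_sign_def expt_sign_def)

lemma pure_not_in_trop_hypersurface:
  assumes "pure p F" "p \<in> TRn"
  shows "p \<notin> trop_hypersurface F"
proof
  assume "p \<in> trop_hypersurface F"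
  then obtain i j where ij: "i \<in> Poly_Mapping.keys F" "j \<in> Poly_Mapping.keys F"
    "\<And>l. l \<in> Poly_Mapping.keys F \<Longrightarrow> trop_weight F p i \<le> trop_weight F p l"
    "\<And>l. l \<in> Poly_Mapping.keys F \<Longrightarrow> trop_weight F p j \<le> trop_weight F p l"
    "trop_sign F p i = 1" "trop_sign F p j = - 1"
    unfolding trop_hypersurface_def by blast
  from assms(1) obtain w s l0 where s: "s = 1 \<or> s = - 1"
    and ge: "\<And>l. lead_ge (w - expt_height p l) (s * expt_sign p l) (Poly_Mapping.lookup F l)"
    and at: "lead_at (w - expt_height p l0) (s * expt_sign p l0) (Poly_Mapping.lookup F l0)"
    unfolding pure_def by blast
  have ss: "s * expt_sign p l = 1 \<or> s * expt_sign p l = - 1" for l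
    using s expt_sign_cases[OF assms(2), of l] by auto
  have l0: "l0 \<in> Poly_Mapping.keys F" using lead_at_nz[OF at] by (simp add: in_keys_iff)
  have w0: "trop_weight F p l0 = w"
    using at l0 lead_at_iff[OF _ ss, of "Poly_Mapping.lookup F l0"] by (simp add: trop_weight_eq in_keys_iff)
  have "trop_sign F p l = s" if l: "l \<in> Poly_Mapping.keys F" "trop_weight F p l \<le> w" for l
  proof -
    have nz: "Poly_Mapping.lookup F l \<noteq> 0" using l by (simp add: in_keys_iff)
    then have "lead_at (w - expt_height p l) (s * expt_sign p l) (Poly_Mapping.lookup F l)"
      using lead_ge_cases[OF ge[of l] ss[of l]] l(2) by (auto simp: trop_weight_eq)
    then have "s * expt_sign p l = puiseux_sign (Poly_Mapping.lookup F l)" using lead_at_iff[OF nz ss] by simp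
    then have "trop_sign F p l = s * (expt_sign p l * expt_sign p l)" by (simp add: trop_sign_eq)
    then show ?thesis using expt_sign_cases[OF assms(2), of l] by auto
  qed
  from this[of i] this[of j] show False using ij l0 w0 by auto
qed

text \<open>A term of minimal weight determines \<open>w\<close> and \<open>s\<close>; a second
  minimal term of the other sign would put \<open>p\<close> on the hypersurface. The zero polynomial
  is excluded because its hypersurface is empty although it has no term that could attain
  \<open>w\<close>.\<close>

lemma not_in_trop_hypersurface_pure:
  assumes "p \<notin> trop_hypersurface F" "p \<in> TRn" "F \<noteq> 0"
  shows "pure p F"
proof -
  let ?W = "trop_weight F p ` Poly_Mapping.keys F"
  have "Poly_Mapping.keys F \<noteq> {}"
    using assms(3) by (metis ex_in_conv in_keys_iff lookup_zero poly_mapping_eqI)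
  then have "Min ?W \<in> ?W" by (intro Min_in) auto
  then obtain l0 where l0: "l0 \<in> Poly_Mapping.keys F" "trop_weight F p l0 = Min ?W" by auto
  have min: "trop_weight F p l0 \<le> trop_weight F p l" if "l \<in> Poly_Mapping.keys F" for l
    using that l0 by simp
  define w where "w = trop_weight F p l0"
  define s where "s = trop_sign F p l0"
  have sgn: "trop_sign F p l = 1 \<or> trop_sign F p l = - 1" for l
    using expt_sign_cases[OF assms(2), of l] puiseux_sign_cases[of "Poly_Mapping.lookup F l"] by (auto simp: trop_sign_eq)
  have s: "s = 1 \<or> s = - 1" unfolding s_def by (rule sgn)
  have same: "trop_sign F p l = s" if "l \<in> Poly_Mapping.keys F" "trop_weight F p l = w" for l
  proof (rule ccontr)
    assume ne: "trop_sign F p l \<noteq> s"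
    have minl: "trop_weight F p l \<le> trop_weight F p l'" if "l' \<in> Poly_Mapping.keys F" for l'
      using min[OF that] \<open>trop_weight F p l = w\<close> by (simp add: w_def)
    have "l \<noteq> l0" using ne by (auto simp: s_def)
    then have "p \<in> trop_hypersurface F"
      unfolding trop_hypersurface_def using ne sgn[of l] s assms(2) l0(1) that(1) min minl
      by (auto simp: s_def) (metis minl)+
    with assms(1) show False ..
  qed
  have at: "lead_at (w - expt_height p l) (s * expt_sign p l) (Poly_Mapping.lookup F l)"
    if l: "l \<in> Poly_Mapping.keys F" "trop_weight F p l = w" for l
  proof -
    have "s * expt_sign p l = puiseux_sign (Poly_Mapping.lookup F l)"
      using same[OF l] expt_sign_cases[OF assms(2), of l] by (auto simp: trop_sign_eq)
    moreover have "s * expt_sign p l = 1 \<or> s * expt_sign p l = - 1"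
      using s expt_sign_cases[OF assms(2), of l] by auto
    ultimately show ?thesis using l by (subst lead_at_iff) (auto simp: in_keys_iff trop_weight_eq)
  qed
  have "lead_ge (w - expt_height p l) (s * expt_sign p l) (Poly_Mapping.lookup F l)" for l
  proof (cases "l \<in> Poly_Mapping.keys F")
    case True
    show ?thesis
    proof (cases "trop_weight F p l = w")
      case False
      then show ?thesis using min[OF True] by (intro lead_ge_greater) (auto simp: w_def trop_weight_eq)
    qed (use at True lead_at_imp_ge in blast)
  qed (simp add: in_keys_iff lead_ge_0)
  moreover have "lead_at (w - expt_height p l0) (s * expt_sign p l0) (Poly_Mapping.lookup F l0)"
    using at l0(1) by (simp add: w_def)
  ultimately show ?thesis unfolding pure_def using s by blast
qed

lemma pure_1: "pure p 1"
proof -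
  have one: "lead_at 0 1 1"
    by (auto simp: lead_at_def lead_ge_def one_puiseux.rep_eq)
  have e: "expt_height p 0 = 0" "expt_sign p 0 = 1" by (simp_all add: expt_height_def expt_sign_def)
  have "lead_ge (0 - expt_height p l) (1 * expt_sign p l) (Poly_Mapping.lookup 1 l)" for l
    using one by (cases "l = 0") (auto simp: lookup_one e lead_ge_0 dest: lead_at_imp_ge)
  moreover have "lead_at (0 - expt_height p 0) (1 * expt_sign p 0) (Poly_Mapping.lookup 1 0)"
    using one by (simp add: e)
  ultimately show ?thesis unfolding pure_def by blast
qed

text \<open>Each coefficient of the product is a sum of products of coefficients that, at the
  critical level, all have the same sign. So nothing cancels, and the term from \<open>l0\<close>
  and \<open>l0'\<close> keeps the minimal weight attained.\<close>

lemma pure_mult: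
  assumes p: "p \<in> TRn" and F: "pure p F" and G: "pure p G"
  shows "pure p (F * G)"
proof -
  obtain w s l0 where s: "s = 1 \<or> s = - 1"
    and ge: "\<And>l. lead_ge (w - expt_height p l) (s * expt_sign p l) (Poly_Mapping.lookup F l)"
    and at: "lead_at (w - expt_height p l0) (s * expt_sign p l0) (Poly_Mapping.lookup F l0)"
    using F unfolding pure_def by blast
  obtain w' s' l0' where s': "s' = 1 \<or> s' = - 1"
    and ge': "\<And>l. lead_ge (w' - expt_height p l) (s' * expt_sign p l) (Poly_Mapping.lookup G l)"
    and at': "lead_at (w' - expt_height p l0') (s' * expt_sign p l0') (Poly_Mapping.lookup G l0')"
    using G unfolding pure_def by blast
  have ss: "s * expt_sign p l = 1 \<or> s * expt_sign p l = - 1" for l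
    using s expt_sign_cases[OF p, of l] by auto
  have ss': "s' * expt_sign p l = 1 \<or> s' * expt_sign p l = - 1" for l
    using s' expt_sign_cases[OF p, of l] by auto
  let ?K = "Poly_Mapping.keys F \<times> Poly_Mapping.keys G"
  \<comment> \<open>Pairs whose sum is not \<open>m\<close> contribute zero, so the index set of the
    sum is the same for every \<open>m\<close>.\<close>
  define t where "t m = (\<lambda>(l, l'). if l + l' = m then Poly_Mapping.lookup F l * Poly_Mapping.lookup G l' else 0)" for m
  have lk: "Poly_Mapping.lookup (F * G) m = (\<Sum>x\<in>?K. t m x)" for m
    unfolding times_poly_mapping_sum[of F G] t_def sum.cartesian_product lookup_sum
    by (intro sum.cong) (auto simp: lookup_single when_def)
  have tge: "lead_ge ((w + w') - expt_height p m) ((s * s') * expt_sign p m) (t m x)" for m x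
  proof -
    obtain l l' where x: "x = (l, l')" by (cases x)
    show ?thesis
    proof (cases "l + l' = m")
      case True
      have eqs: "(w + w') - expt_height p m = (w - expt_height p l) + (w' - expt_height p l')"
        "(s * s') * expt_sign p m = (s * expt_sign p l) * (s' * expt_sign p l')"
        unfolding True[symmetric] by (simp_all add: expt_height_add expt_sign_add)
      show ?thesis unfolding t_def x eqs using lead_ge_mult[OF ge ge' ss ss', of l l'] True by simp
    qed (simp add: t_def x lead_ge_0)
  qed
  have "lead_at ((w + w') - expt_height p (l0 + l0')) ((s * s') * expt_sign p (l0 + l0'))
      (Poly_Mapping.lookup (F * G) (l0 + l0'))"
    unfolding lk
  proof (rule lead_at_sum)
    show "(l0, l0') \<in> ?K" using lead_at_nz[OF at] lead_at_nz[OF at'] by (simp add: in_keys_iff)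
    have eqs: "(w + w') - expt_height p (l0 + l0') = (w - expt_height p l0) + (w' - expt_height p l0')"
      "(s * s') * expt_sign p (l0 + l0') = (s * expt_sign p l0) * (s' * expt_sign p l0')"
      by (simp_all add: expt_height_add expt_sign_add)
    show "lead_at ((w + w') - expt_height p (l0 + l0')) ((s * s') * expt_sign p (l0 + l0')) (t (l0 + l0') (l0, l0'))"
      unfolding t_def eqs using lead_at_mult[OF at at' ss ss'] by simp
  qed (use tge in auto)
  moreover have "lead_ge ((w + w') - expt_height p m) ((s * s') * expt_sign p m) (Poly_Mapping.lookup (F * G) m)" for m
    unfolding lk using tge by (intro lead_ge_sum)
  moreover have "s * s' = 1 \<or> s * s' = - 1" using s s' by auto
  ultimately show ?thesis unfolding pure_def by blast
qed

lemma pure_prod: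
  assumes "p \<in> TRn" "\<And>i. i \<in> A \<Longrightarrow> pure p (F i)"
  shows "pure p (\<Prod>i\<in>A. F i)"
  using assms(2) by (induction A rule: infinite_finite_induct) (auto intro: pure_1 pure_mult[OF assms(1)])

text \<open>The only terms are the variable and the constant \<open>- c\<close>. They have equal
  weight and opposite signs at \<open>p\<close> exactly if \<open>p $ k\<close> has the modulus and
  the sign of \<open>trop c\<close>.\<close>

lemma pure_linear:
  fixes p :: "(real \<times> real) ^ 'n::finite"
  assumes p: "p \<in> TRn" and c: "c \<noteq> 0" and ne: "p $ k \<noteq> trop c"
  shows "pure p (Var k - Cst c)"
proof (rule not_in_trop_hypersurface_pure)
  let ?F = "Var k - Cst c" and ?e = "Poly_Mapping.single k (1::nat)"
  have e0: "?e \<noteq> 0" by (metis lookup_single_eq lookup_zero one_neq_zero)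
  have lk: "Poly_Mapping.lookup ?F l = (if l = ?e then 1 else if l = 0 then - c else 0)" for l
    using e0 by (auto simp: Var_def Cst_def lookup_minus lookup_single when_def)
  have keys: "Poly_Mapping.keys ?F = {?e, 0}" using c by (auto simp: in_keys_iff lk split: if_splits)
  show "?F \<noteq> 0" using keys by auto
  have w: "trop_weight ?F p ?e = snd (p $ k)" "trop_weight ?F p 0 = real_of_rat (puiseux_val c)"
  proof -
    have "puiseux_val 1 = 0"
      unfolding puiseux_val_def by (rule Least_equality) (auto simp: one_puiseux.rep_eq split: if_splits)
    moreover have "expt_height p ?e = snd (p $ k)"
      by (simp add: expt_height_def lookup_single when_def if_distrib[of real] if_distrib[of "\<lambda>x. x * _"] sum.delta' cong: if_cong)
    ultimately show "trop_weight ?F p ?e = snd (p $ k)" by (simp add: trop_weight_eq lk)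
    have "puiseux_val (- c) = puiseux_val c" by (simp add: puiseux_val_def uminus_puiseux.rep_eq)
    then show "trop_weight ?F p 0 = real_of_rat (puiseux_val c)"
      using e0 by (simp add: trop_weight_eq lk expt_height_def)
  qed
  have sg: "trop_sign ?F p ?e = fst (p $ k)" "trop_sign ?F p 0 = - puiseux_sign c"
  proof -
    have "expt_sign p ?e = (\<Prod>j\<in>UNIV. if j = k then fst (p $ k) else 1)"
      unfolding expt_sign_def by (intro prod.cong) (auto simp: lookup_single when_def)
    then have "expt_sign p ?e = fst (p $ k)" by simp
    moreover have "puiseux_sign 1 = 1" by (simp add: puiseux_sign_def)
    ultimately show "trop_sign ?F p ?e = fst (p $ k)" by (simp add: trop_sign_eq lk)
    show "trop_sign ?F p 0 = - puiseux_sign c"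
      using e0 c by (auto simp: trop_sign_eq lk expt_sign_def puiseux_sign_def)
  qed
  show "p \<notin> trop_hypersurface ?F"
  proof
    assume "p \<in> trop_hypersurface ?F"
    then have "trop_weight ?F p ?e = trop_weight ?F p 0" "trop_sign ?F p ?e = - trop_sign ?F p 0"
      unfolding trop_hypersurface_def keys by (auto intro: antisym)
    then have "p $ k = trop c" unfolding w sg by (simp add: trop_def prod_eq_iff)
    with ne show False ..
  qed
qed (rule p)

lemma trop_vec_TRn: "trop_vec x \<in> TRn"
  by (auto simp: TRn_def TR_def trop_vec_def trop_def puiseux_sign_def)

section \<open>Evaluation at points of the torus\<close>

lemma lead_at_mono_eval:
  assumes x: "x \<in> torus"
  shows "lead_at (expt_height (trop_vec x) l) (expt_sign (trop_vec x) l) (mono_eval l x)"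
proof -
  have one: "lead_at 0 1 1"
    by (auto simp: lead_at_def lead_ge_def one_puiseux.rep_eq)
  have sg: "puiseux_sign (x $ k) ^ n = 1 \<or> puiseux_sign (x $ k) ^ n = - 1" for k n
    by (rule sign_power[OF puiseux_sign_cases])
  have 1: "lead_at (real n * real_of_rat (puiseux_val (x $ k))) (puiseux_sign (x $ k) ^ n) (x $ k ^ n)" for k n
  proof (induction n)
    case (Suc n)
    have "x $ k \<noteq> 0" using x by (simp add: torus_def)
    then have "lead_at (real_of_rat (puiseux_val (x $ k))) (puiseux_sign (x $ k)) (x $ k)"
      using puiseux_sign_cases by (simp add: lead_at_iff)
    from lead_at_mult[OF this Suc puiseux_sign_cases sg] show ?case by (simp add: algebra_simps)
  qed (use one in simp)
  \<comment> \<open>That the sign is \<open>1\<close> or \<open>- 1\<close> is carried along in the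
    induction because \<open>lead_at_mult\<close> asks for it.\<close>
  have "lead_at (\<Sum>k\<in>A. real (Poly_Mapping.lookup l k) * real_of_rat (puiseux_val (x $ k)))
      (\<Prod>k\<in>A. puiseux_sign (x $ k) ^ Poly_Mapping.lookup l k) (\<Prod>k\<in>A. x $ k ^ Poly_Mapping.lookup l k)
    \<and> ((\<Prod>k\<in>A. puiseux_sign (x $ k) ^ Poly_Mapping.lookup l k) = 1
      \<or> (\<Prod>k\<in>A. puiseux_sign (x $ k) ^ Poly_Mapping.lookup l k) = - 1)" for A
  proof (induction A rule: infinite_finite_induct)
    case (insert k A)
    let ?n = "Poly_Mapping.lookup l k"
    have "lead_at (real ?n * real_of_rat (puiseux_val (x $ k))
          + (\<Sum>k\<in>A. real (Poly_Mapping.lookup l k) * real_of_rat (puiseux_val (x $ k))))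
        (puiseux_sign (x $ k) ^ ?n * (\<Prod>k\<in>A. puiseux_sign (x $ k) ^ Poly_Mapping.lookup l k))
        (x $ k ^ ?n * (\<Prod>k\<in>A. x $ k ^ Poly_Mapping.lookup l k))"
      by (rule lead_at_mult[OF 1 _ sg]) (use insert in auto)
    then show ?case using insert sg[of k ?n] by auto
  qed (use one in simp_all)
  then show ?thesis by (simp add: expt_height_def expt_sign_def mono_eval_def trop_vec_def trop_def)
qed

text \<open>In each term the monomial sign occurs twice and cancels. All terms therefore have level
  at least \<open>w\<close>, with sign \<open>s\<close> at level \<open>w\<close>; one of them
  attains it, so the sum keeps a nonzero leading term.\<close>

lemma pure_poly_eval_nz:
  assumes x: "x \<in> torus" and F: "pure (trop_vec x) F"
  shows "poly_eval F x \<noteq> 0"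
proof -
  let ?p = "trop_vec x"
  note p = trop_vec_TRn[of x]
  obtain w s l0 where s: "s = 1 \<or> s = - 1"
    and ge: "\<And>l. lead_ge (w - expt_height ?p l) (s * expt_sign ?p l) (Poly_Mapping.lookup F l)"
    and at: "lead_at (w - expt_height ?p l0) (s * expt_sign ?p l0) (Poly_Mapping.lookup F l0)"
    using F unfolding pure_def by blast
  have ss: "s * expt_sign ?p l = 1 \<or> s * expt_sign ?p l = - 1" for l
    using s expt_sign_cases[OF p, of l] by auto
  have eq: "s * expt_sign ?p l * expt_sign ?p l = s" for l
    using expt_sign_cases[OF p, of l] by auto
  have "lead_ge w s (Poly_Mapping.lookup F l * mono_eval l x)" for l
    using lead_ge_mult[OF ge lead_at_imp_ge[OF lead_at_mono_eval[OF x]] ss expt_sign_cases[OF p], of l l]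
    by (simp add: eq)
  moreover have "lead_at w s (Poly_Mapping.lookup F l0 * mono_eval l0 x)"
    using lead_at_mult[OF at lead_at_mono_eval[OF x] ss expt_sign_cases[OF p], of l0] by (simp add: eq)
  moreover have "l0 \<in> Poly_Mapping.keys F" using lead_at_nz[OF at] by (simp add: in_keys_iff)
  ultimately have "lead_at w s (poly_eval F x)"
    unfolding poly_eval_superset[OF finite_keys order_refl] by (intro lead_at_sum) auto
  then show ?thesis by (rule lead_at_nz)
qed

theorem theorem3p4:
  fixes I :: "'n::finite kpoly set"
  assumes "is_ideal I"
    and "real_radical I"
    and "zero_dimensional I"
    and "variety I \<subseteq> torus"
  shows "\<exists>B. real_tropical_basis B I"
proof -
  obtain B1 where B1: "finite B1" "B1 \<subseteq> I" and fin: "finite (variety I)"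
    and gen: "\<And>F. (\<And>x. x \<in> variety I \<Longrightarrow> poly_eval F x = 0) \<Longrightarrow> F \<in> ideal_gen B1"
    using real_radical_zero_dimensional[OF assms(1-3)] by metis
  have II: "F \<in> I" if "\<And>x. x \<in> variety I \<Longrightarrow> poly_eval F x = 0" for F
    using gen[OF that] ideal_gen_minimal[OF assms(1) B1(2)] by blast
  \<comment> \<open>The product depends only on the values of \<open>\<phi>\<close> on the finite
    variety, so the finitely many extensional functions yield all of these products.\<close>
  define Q where "Q \<phi> = (\<Prod>x\<in>variety I. Var (\<phi> x) - Cst (x $ \<phi> x))" for \<phi>
  define B2 where "B2 = Q ` PiE (variety I) (\<lambda>_. UNIV)"
  \<comment> \<open>The set \<open>trop_hypersurface 0\<close> is empty, so a zero generator would
    make the whole intersection empty.\<close>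
  define B where "B = (B1 \<union> B2) - {0}"
  have "finite B2" unfolding B2_def using fin by (intro finite_imageI finite_PiE) auto
  have "Q \<phi> \<in> I" for \<phi>
  proof (rule II)
    fix x assume "x \<in> variety I"
    then show "poly_eval (Q \<phi>) x = 0"
      using fin by (auto simp: Q_def poly_eval_prod poly_eval_diff)
  qed
  then have BI: "B \<subseteq> I" using B1 by (auto simp: B_def B2_def)
  have "ideal_gen B = I"
  proof
    show "ideal_gen B \<subseteq> I" by (rule ideal_gen_minimal[OF assms(1) BI])
    have "B1 \<subseteq> ideal_gen B"
      using ideal_gen_superset[of _ B] is_ideal_0[OF is_ideal_gen[of B]] by (auto simp: B_def)
    then have "ideal_gen B1 \<subseteq> ideal_gen B" by (rule ideal_gen_minimal[OF is_ideal_gen])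
    then show "I \<subseteq> ideal_gen B" using gen by (auto simp: variety_def)
  qed
  moreover have "finite B" using B1 \<open>finite B2\<close> by (simp add: B_def)
  moreover have "trop_variety I = TRn \<inter> (\<Inter>F\<in>B. trop_hypersurface F)"
  proof -
    have "closed (trop_vec ` variety I)" using fin by (intro finite_imp_closed finite_imageI)
    then have "closedin (top_of_set TRn) (trop_vec ` variety I)"
      by (rule closed_subset[rotated]) (auto simp: trop_vec_TRn)
    then have tv: "trop_variety I = trop_vec ` variety I"
      unfolding trop_variety_def using assms(4) by (simp add: Int_absorb2 closure_of_eq)
    show ?thesis
      unfolding tv
    proof (intro equalityI subsetI)
      fix p assume "p \<in> trop_vec ` variety I"
      then obtain x where x: "x \<in> variety I" "p = trop_vec x" by blast
      have "p \<in> trop_hypersurface F" if F: "F \<in> B" for F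
      proof (rule ccontr)
        assume "p \<notin> trop_hypersurface F"
        then have "pure p F"
          using F x trop_vec_TRn by (intro not_in_trop_hypersurface_pure) (auto simp: B_def)
        then have "poly_eval F x \<noteq> 0" using x assms(4) by (intro pure_poly_eval_nz) auto
        then show False using F BI x by (auto simp: variety_def)
      qed
      then show "p \<in> TRn \<inter> (\<Inter>F\<in>B. trop_hypersurface F)" using x trop_vec_TRn by auto
    next
      fix p assume p: "p \<in> TRn \<inter> (\<Inter>F\<in>B. trop_hypersurface F)"
      show "p \<in> trop_vec ` variety I"
      proof (rule ccontr)
        assume "p \<notin> trop_vec ` variety I"
        then have "\<exists>k. p $ k \<noteq> trop (x $ k)" if "x \<in> variety I" for x
          using that by (auto simp: trop_vec_def vec_eq_iff image_iff)
        then obtain \<phi> where \<phi>: "\<And>x. x \<in> variety I \<Longrightarrow> p $ \<phi> x \<noteq> trop (x $ \<phi> x)" by metis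
        \<comment> \<open>Restriction makes the choice of coordinates extensional, so that
          \<open>Q \<psi>\<close> belongs to \<open>B2\<close>.\<close>
        define \<psi> where "\<psi> = restrict \<phi> (variety I)"
        have "pure p (Q \<psi>)"
          unfolding Q_def using p \<phi> assms(4)
          by (intro pure_prod pure_linear) (auto simp: \<psi>_def torus_def)
        then have out: "p \<notin> trop_hypersurface (Q \<psi>)" using p by (intro pure_not_in_trop_hypersurface) auto
        have "Q \<psi> \<noteq> 0"
        proof
          assume "Q \<psi> = 0"
          with \<open>pure p (Q \<psi>)\<close> show False by (auto simp: pure_def dest: lead_at_nz)
        qed
        moreover have "Q \<psi> \<in> B2" unfolding B2_def \<psi>_def by (intro imageI) auto
        ultimately show False using out p by (auto simp: B_def)
      qed
    qed
  qed
  ultimately show ?thesis unfolding real_tropical_basis_def by blast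
qed

end
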